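(* Let $\varphi:D\to D$ be an analytic self-map of $D$, let $g\in H(D)$, and let $0<\beta<\infty$. Let $C_\varphi V_g$ be the operator $(C_\varphi V_g f)(z)=\int_0^{\varphi(z)} f'(\xi)g(\xi)\,d\xi$. (i) If $0<\alpha<1$, then $C_\varphi V_g:\mathcal{Z}^\alpha\to\mathcal{Z}^\beta$ is a bounded operator if and only if $(g\circ\varphi)\varphi''+(g'\circ\varphi)(\varphi')^2\in H^\infty_{v_\beta}$ and $$\sup_{n\ge 0}(n+1)^\alpha\|(g\circ\varphi)(\varphi')^2\varphi^n\|_{v_\beta}\asymp\sup_{z\in D}\frac{(1-|z|^2)^\beta}{(1-|\varphi(z)|^2)^\alpha}|g(\varphi(z))(\varphi'(z))^2|<\infty.$$ (ii) If $\alpha=1$, then $C_\varphi V_g:\mathcal{Z}^\alpha\to\mathcal{Z}^\beta$ is a bounded operator if and only if $$\sup_{n\ge 0}(n+1)\|(g\circ\varphi)(\varphi')^2\varphi^n\|_{v_\beta}\asymp\sup_{z\in D}\frac{(1-|z|^2)^\beta}{1-|\varphi(z)|^2}|g(\varphi(z))(\varphi'(z))^2|<\infty$$ and $$\sup_{n\ge 0}\log(n+2)\,\|((g'\circ\varphi)(\varphi')^2+(g\circ\varphi)\varphi'')\varphi^n\|_{v_\beta}\asymp\sup_{z\in D}(1-|z|^2)^\beta\log\Big(\frac{2}{1-|\varphi(z)|^2}\Big)|g'(\varphi(z))(\varphi'(z))^2+g(\varphi(z))\varphi''(z)|<\infty.$$ (iii) If $\alpha>1$, then $C_\varphi V_g:\mathcal{Z}^\alpha\to\mathcal{Z}^\beta$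 is a bounded operator if and only if $$\sup_{n\ge 0}(n+1)^\alpha\|(g\circ\varphi)(\varphi')^2\varphi^n\|_{v_\beta}\asymp\sup_{z\in D}\frac{(1-|z|^2)^\beta}{(1-|\varphi(z)|^2)^\alpha}|g(\varphi(z))(\varphi'(z))^2|<\infty$$ and $$\sup_{n\ge 0}(n+1)^{\alpha-1}\|((g'\circ\varphi)(\varphi')^2+(g\circ\varphi)\varphi'')\varphi^n\|_{v_\beta}\asymp\sup_{z\in D}\frac{(1-|z|^2)^\beta}{(1-|\varphi(z)|^2)^{\alpha-1}}|g'(\varphi(z))(\varphi'(z))^2+g(\varphi(z))\varphi''(z)|<\infty.$$
   Context: $D=\{z\in\mathbb{C}:|z|<1\}$ and $H(D)$ is the set of analytic functions on $D$. For $0<\alpha<\infty$, the Zygmund type space $\mathcal{Z}^\alpha$ is the Banach space of $f\in H(D)$ with $\sup_{z\in D}(1-|z|^2)^\alpha|f''(z)|<\infty$, normed by $\|f\|_{\mathcal{Z}^\alpha}=|f(0)|+|f'(0)|+\sup_{z\in D}(1-|z|^2)^\alpha|f''(z)|$. For $0<\beta<\infty$, $v_\beta(z)=(1-|z|^2)^\beta$, $\|h\|_{v_\beta}=\sup_{z\in D}v_\beta(z)|h(z)|$ (possibly $+\infty$) for $h\in H(D)$, and $H^\infty_{v_\beta}=\{h\in H(D):\|h\|_{v_\beta}<\infty\}$. $\varphi^n$ denotes the $n$-th power (pointwise product) of $\varphi$, with $\varphi^0=1$. $A\asymp B$ means that there are positive constants $C_1,C_2$ with $C_1A\le B\le C_2A$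 (constants not depending on $g$ or $\varphi$); a condition "$A\asymp B<\infty$" means that the two quantities are comparable and finite. *)

theory Defs
  imports "HOL-Complex_Analysis.Complex_Analysis"
begin

text \<open>
  Elements of $H(D)$ are total functions that are holomorphic on the open unit disc; their
  values off the disc are irrelevant to every notion below. Norms and suprema that may be
  infinite take values in \<^typ>\<open>ennreal\<close>.
\<close>

abbreviation unit_disc :: "complex set" where
  "unit_disc \<equiv> ball 0 1"

definition weight :: "real \<Rightarrow> complex \<Rightarrow> real" where
  "weight \<beta> z = (1 - (norm z)\<^sup>2) powr \<beta>"

definition weighted_norm :: "real \<Rightarrow> (complex \<Rightarrow> complex) \<Rightarrow> ennreal" where
  "weighted_norm \<beta> h = (SUP z\<in>unit_disc. ennreal (weight \<beta> z * norm (h z)))"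

definition weighted_Hinf :: "real \<Rightarrow> (complex \<Rightarrow> complex) set" where
  "weighted_Hinf \<beta> = {h. h holomorphic_on unit_disc \<and> weighted_norm \<beta> h < \<infinity>}"

definition zygmund_norm :: "real \<Rightarrow> (complex \<Rightarrow> complex) \<Rightarrow> ennreal" where
  "zygmund_norm \<alpha> f =
     ennreal (norm (f 0)) + ennreal (norm (deriv f 0)) +
     weighted_norm \<alpha> (deriv (deriv f))"

definition zygmund :: "real \<Rightarrow> (complex \<Rightarrow> complex) set" where
  "zygmund \<alpha> = {f. f holomorphic_on unit_disc \<and>
     weighted_norm \<alpha> (deriv (deriv f)) < \<infinity>}"

text \<open>
  The integral from $0$ to $\varphi(z)$ is taken along the straight segment; the integrand is
  holomorphic on the disc, so the choice of path in the disc is immaterial.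
\<close>

definition CV :: "(complex \<Rightarrow> complex) \<Rightarrow> (complex \<Rightarrow> complex) \<Rightarrow>
    (complex \<Rightarrow> complex) \<Rightarrow> complex \<Rightarrow> complex" where
  "CV \<phi> g f z = contour_integral (linepath 0 (\<phi> z)) (\<lambda>\<xi>. deriv f \<xi> * g \<xi>)"

text \<open>
  Linearity is required on the disc only, since functions that agree on the disc represent the
  same element of the space.
\<close>

definition bounded_zygmund_operator ::
    "real \<Rightarrow> real \<Rightarrow> ((complex \<Rightarrow> complex) \<Rightarrow> complex \<Rightarrow> complex) \<Rightarrow> bool" where
  "bounded_zygmund_operator \<alpha> \<beta> T \<longleftrightarrow>
     (\<forall>f\<in>zygmund \<alpha>. T f \<in> zygmund \<beta>) \<and>
     (\<forall>f\<in>zygmund \<alpha>. \<forall>h\<in>zygmund \<alpha>. \<forall>a b. \<forall>z\<in>unit_disc.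
        T (\<lambda>w. a * f w + b * h w) z = a * T f z + b * T h z) \<and>
     (\<exists>C\<ge>0. \<forall>f\<in>zygmund \<alpha>. zygmund_norm \<beta> (T f) \<le> ennreal C * zygmund_norm \<alpha> f)"

text \<open>
  $A \asymp B < \infty$ with explicit comparison constants, so that a statement can
  quantify the constants before the functions they must not depend on.
\<close>

definition comparable_finite :: "real \<Rightarrow> real \<Rightarrow> ennreal \<Rightarrow> ennreal \<Rightarrow> bool" where
  "comparable_finite C1 C2 A B \<longleftrightarrow>
     ennreal C1 * A \<le> B \<and> B \<le> ennreal C2 * A \<and> A < \<infinity> \<and> B < \<infinity>"

end

theory Submission
  imports Defs
begin

text \<open>
  Write \<open>u = (g \<circ> \<phi>) (\<phi>')\<^sup>2\<close> and \<open>w = (g' \<circ> \<phi>) (\<phi>')\<^sup>2 + (g \<circ> \<phi>) \<phi>''\<close>. Differentiating \<open>T f = CV \<phi> g f\<close>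
  twice gives \<open>(T f)'' = (f'' \<circ> \<phi>) u + (f' \<circ> \<phi>) w\<close> (\<open>CV_derivatives\<close>), so the question is how large
  \<open>f''\<close> and \<open>f'\<close> can be at the point \<open>\<phi> z\<close> when \<open>f\<close> runs through the unit ball of the Zygmund type
  space. For \<open>f''\<close> the answer is \<open>(1 - |\<phi> z|\<^sup>2)\<^bsup>-\<alpha>\<^esup>\<close>, by definition of the norm; for \<open>f'\<close> it is, up to
  constants, \<open>1\<close> when \<open>\<alpha> < 1\<close>, \<open>ln (2 / (1 - |\<phi> z|\<^sup>2))\<close> when \<open>\<alpha> = 1\<close> and \<open>(1 - |\<phi> z|\<^sup>2)\<^bsup>1-\<alpha>\<^esup>\<close> when
  \<open>\<alpha> > 1\<close>, as integrating \<open>f''\<close> along a radius shows (\<open>zygmund_deriv_growth\<close>). Weighted bounds for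
  \<open>u\<close> and \<open>w\<close> against these two sizes are therefore sufficient for boundedness.
  
  They are also necessary. Let \<open>a = \<phi> z\<close>. A difference of two Cauchy-type kernels with pole at the
  reflection of \<open>a\<close> is a choice of \<open>f'\<close> that vanishes at \<open>a\<close> while \<open>f''\<close> has its extremal size
  there, which isolates \<open>u\<close>; it degenerates only near \<open>a = 0\<close>, where the affine and quadratic
  functions do the job. Once \<open>u\<close> is under control, a single kernel (or a logarithm, or a constant)
  that realizes the extremal size of \<open>f'\<close> gives the bound for \<open>w\<close>, because its \<open>f'' u\<close> term is
  already bounded (\<open>bounded_CV_iff\<close>).
  
  The suprema over \<open>n\<close> are compared with the suprema over \<open>z\<close> pointwise. For \<open>0 \<le> r < 1\<close> the
  supremum over \<open>n\<close> of \<open>(n + 1)\<^sup>\<gamma> r\<^sup>n\<close> is comparable with \<open>(1 - r\<^sup>2)\<^bsup>-\<gamma>\<^esup>\<close>, and that of \<open>ln (n + 2) r\<^sup>n\<close> with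
  \<open>ln (2 / (1 - r\<^sup>2))\<close>, both being attained, up to constants, at an
  \<open>n\<close> of order \<open>1 / (1 - r)\<close>. Put \<open>r = |\<phi> z|\<close>, multiply
  by the weight and interchange the two suprema: the two quantities are comparable for all
  \<open>\<phi>\<close> and \<open>g\<close>, with constants that depend on the exponent only, so that each comparability condition
  says just that the supremum over \<open>z\<close> is finite (\<open>comparable_finite_moments\<close>).
\<close>

section \<open>Moments of the radius\<close>

lemma one_minus_square_bounds:
  fixes r :: real
  assumes "0 \<le> r" "r < 1"
  shows "0 < 1 - r\<^sup>2" "1 - r\<^sup>2 \<le> 1" "1 - r\<^sup>2 \<le> 2 * (1 - r)"
proof -
  have "1 - r\<^sup>2 = (1 - r) * (1 + r)" by (simp add: power2_eq_square algebra_simps)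
  moreover have "(1 - r) * (1 + r) \<le> (1 - r) * 2"
    using assms by (intro mult_left_mono) auto
  ultimately show "1 - r\<^sup>2 \<le> 2 * (1 - r)" by simp
  show "0 < 1 - r\<^sup>2" using assms by (simp add: power_less_one_iff abs_square_less_1)
qed simp

text \<open>
  Since \<open>r\<^sup>n \<le> exp (- n (1 - r))\<close>, the product is controlled by \<open>x\<^sup>\<gamma> exp (- x)\<close> with
  \<open>x = (n + 1) (1 - r)\<close>, and \<open>x / \<gamma> \<le> exp (x / \<gamma>)\<close> bounds this by \<open>\<gamma>\<^sup>\<gamma>\<close>.
\<close>

lemma power_moment_upper:
  fixes \<gamma> r :: real
  assumes "0 < \<gamma>" "0 \<le> r" "r < 1"
  shows "(real n + 1) powr \<gamma> * r ^ n \<le> ((2 * \<gamma>) powr \<gamma> * exp 1) * (1 - r\<^sup>2) powr (- \<gamma>)"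
proof -
  define x where "x = (real n + 1) * (1 - r)"
  note s = one_minus_square_bounds[OF assms(2,3)]
  have x: "0 < x" using assms by (simp add: x_def)
  have "x / \<gamma> \<le> exp (x / \<gamma>)"
    using exp_ge_add_one_self[of "x / \<gamma>"] by linarith
  then have "x \<le> \<gamma> * exp (x / \<gamma>)"
    using assms(1) by (simp add: field_simps)
  then have "x powr \<gamma> \<le> (\<gamma> * exp (x / \<gamma>)) powr \<gamma>"
    using assms x by (intro powr_mono2) auto
  also have "\<dots> = \<gamma> powr \<gamma> * exp x"
    using assms by (simp add: powr_mult exp_powr_real)
  finally have xg: "x powr \<gamma> \<le> \<gamma> powr \<gamma> * exp x" .
  have "r ^ n \<le> exp (- (1 - r)) ^ n"
    using assms exp_ge_add_one_self[of "- (1 - r)"] by (intro power_mono) auto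
  also have "\<dots> = exp (- (real n * (1 - r)))"
    by (simp add: exp_of_nat_mult[symmetric] algebra_simps)
  also have "\<dots> \<le> exp (1 - x)"
    using assms by (simp add: x_def algebra_simps)
  finally have rn: "r ^ n \<le> exp (1 - x)" .
  have "(real n + 1) powr \<gamma> * (1 - r\<^sup>2) powr \<gamma> = ((real n + 1) * (1 - r\<^sup>2)) powr \<gamma>"
    using s by (simp add: powr_mult)
  also have "\<dots> \<le> (2 * x) powr \<gamma>"
  proof (intro powr_mono2)
    show "(real n + 1) * (1 - r\<^sup>2) \<le> 2 * x"
      using mult_left_mono[OF s(3), of "real n + 1"] by (simp add: x_def)
  qed (use s assms in auto)
  also have "\<dots> = 2 powr \<gamma> * x powr \<gamma>" using x by (simp add: powr_mult)
  finally have "(real n + 1) powr \<gamma> * (1 - r\<^sup>2) powr \<gamma> * r ^ n \<le> 2 powr \<gamma> * x powr \<gamma> * exp (1 - x)"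
    using rn assms by (intro mult_mono[of "(real n + 1) powr \<gamma> * (1 - r\<^sup>2) powr \<gamma>"]) auto
  also have "\<dots> \<le> 2 powr \<gamma> * (\<gamma> powr \<gamma> * exp x) * exp (1 - x)"
    using xg by (intro mult_right_mono mult_left_mono) auto
  also have "\<dots> = (2 * \<gamma>) powr \<gamma> * exp 1"
    using assms by (simp add: powr_mult exp_diff)
  finally have "(real n + 1) powr \<gamma> * (1 - r\<^sup>2) powr \<gamma> * r ^ n \<le> (2 * \<gamma>) powr \<gamma> * exp 1" .
  then show ?thesis
    using s(1) by (simp add: powr_minus field_simps)
qed

text \<open>
  The \<open>n\<close> that nearly maximizes the moments: large enough to match \<open>1 / (1 - r\<^sup>2)\<close>, yet small
  enough that, by the Bernoulli inequality for \<open>r\<^bsup>2n\<^esup> = (1 - (1 - r\<^sup>2))\<^sup>n\<close>, the power \<open>r\<^sup>n\<close> has not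
  decayed.
\<close>

lemma exists_balanced_power:
  fixes r :: real
  assumes "0 \<le> r" "r < 1"
  shows "\<exists>n. 1 / (2 * (1 - r\<^sup>2)) < real n + 1 \<and> 1 / 2 \<le> r ^ n"
proof -
  define s where "s = 1 - r\<^sup>2"
  note b = one_minus_square_bounds[OF assms, folded s_def]
  define n where "n = nat \<lfloor>1 / (2 * s)\<rfloor>"
  have n: "real n \<le> 1 / (2 * s)" "1 / (2 * s) < real n + 1"
    using b unfolding n_def by (auto simp: of_nat_nat)
  have "1 / 2 \<le> 1 + real n * (- s)"
    using n(1) b by (simp add: field_simps)
  also have "\<dots> \<le> (1 + (- s)) ^ n"
    using b by (intro Bernoulli_inequality) auto
  also have "\<dots> = r ^ n * r ^ n" by (simp add: s_def power2_eq_square power_mult_distrib)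
  also have "\<dots> \<le> r ^ n * 1" using assms by (intro mult_left_mono power_le_one) auto
  finally show ?thesis using n(2) unfolding s_def by auto
qed

lemma power_moment_lower:
  fixes \<gamma> r :: real
  assumes "0 < \<gamma>" "0 \<le> r" "r < 1"
  shows "\<exists>n. (2 powr (- \<gamma>) / 2) * (1 - r\<^sup>2) powr (- \<gamma>) \<le> (real n + 1) powr \<gamma> * r ^ n"
proof -
  note s = one_minus_square_bounds[OF assms(2,3)]
  obtain n where n: "1 / (2 * (1 - r\<^sup>2)) < real n + 1" "1 / 2 \<le> r ^ n"
    using exists_balanced_power assms by blast
  have "2 powr (- \<gamma>) * (1 - r\<^sup>2) powr (- \<gamma>) = (2 * (1 - r\<^sup>2)) powr (- \<gamma>)"
    using s by (subst powr_mult) auto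
  also have "\<dots> = (1 / (2 * (1 - r\<^sup>2))) powr \<gamma>"
    using s by (simp only: powr_divide powr_minus_divide) simp
  also have "\<dots> \<le> (real n + 1) powr \<gamma>"
    using n s assms by (intro powr_mono2) auto
  finally have "2 powr (- \<gamma>) * (1 - r\<^sup>2) powr (- \<gamma>) * (1 / 2) \<le> (real n + 1) powr \<gamma> * r ^ n"
    using n by (intro mult_mono) auto
  then show ?thesis by (auto intro!: exI[of _ n])
qed

text \<open>
  Relative to \<open>2 / (1 - r\<^sup>2)\<close>, the excess of \<open>n + 2\<close> enters the logarithm only additively and at
  most linearly, and linear growth in \<open>n\<close> is absorbed by \<open>r\<^sup>n\<close> (the case \<open>\<gamma> = 1\<close> of the power
  moments).
\<close>

lemma log_moment_upper:
  fixes r :: real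
  assumes "0 \<le> r" "r < 1"
  shows "ln (real n + 2) * r ^ n \<le> (1 + 2 * exp 1 / ln 2) * ln (2 / (1 - r\<^sup>2))"
proof -
  define s where "s = 1 - r\<^sup>2"
  note b = one_minus_square_bounds[OF assms, folded s_def]
  have "ln 2 \<le> ln (2 / s)" using b by (simp add: field_simps)
  then have l2: "1 \<le> ln (2 / s) / ln 2" by simp
  have "ln (real n + 2) = ln (2 / s * ((real n + 2) * s / 2))"
    using b by simp
  also have "\<dots> = ln (2 / s) + ln ((real n + 2) * s / 2)"
    using b by (intro ln_mult_pos) auto
  also have "\<dots> \<le> ln (2 / s) + (real n + 1) * s"
  proof -
    have "ln ((real n + 2) * s / 2) \<le> (real n + 2) * s / 2 - 1"
      using b by (intro ln_le_minus_one) auto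
    also have "\<dots> \<le> (real n + 1) * s" using b by (simp add: field_simps)
    finally show ?thesis by simp
  qed
  finally have "ln (real n + 2) * r ^ n \<le> (ln (2 / s) + (real n + 1) * s) * r ^ n"
    using assms by (intro mult_right_mono) auto
  also have "\<dots> = ln (2 / s) * r ^ n + (real n + 1) * r ^ n * s" by (simp add: algebra_simps)
  also have "\<dots> \<le> ln (2 / s) * 1 + 2 * exp 1 * 1"
  proof (intro add_mono mult_left_mono)
    show "r ^ n \<le> 1" using assms by (simp add: power_le_one)
    show "0 \<le> ln (2 / s)" using b by simp
    show "(real n + 1) * r ^ n * s \<le> 2 * exp 1 * 1"
      using power_moment_upper[of 1 r n, folded s_def] assms b
      by (simp add: powr_minus field_simps)
  qed
  also have "\<dots> \<le> ln (2 / s) + 2 * exp 1 * (ln (2 / s) / ln 2)"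
    using l2 by (intro add_mono mult_left_mono) auto
  also have "\<dots> = (1 + 2 * exp 1 / ln 2) * ln (2 / s)" by (simp add: algebra_simps)
  finally show ?thesis unfolding s_def .
qed

lemma log_moment_lower:
  fixes r :: real
  assumes "0 \<le> r" "r < 1"
  shows "\<exists>n. (1 / 4) * ln (2 / (1 - r\<^sup>2)) \<le> ln (real n + 2) * r ^ n"
proof -
  define s where "s = 1 - r\<^sup>2"
  note b = one_minus_square_bounds[OF assms, folded s_def]
  obtain n where n: "1 / (2 * s) < real n + 1" "1 / 2 \<le> r ^ n"
    using exists_balanced_power[OF assms] unfolding s_def by blast
  define y where "y = 1 / (2 * s)"
  have "2 / s = 4 * y" using b by (simp add: y_def)
  \<comment> \<open>Comparing with the square of \<open>n + 2\<close> costs only a factor 2 after taking logarithms.\<close>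
  also have "\<dots> \<le> (y + 1)\<^sup>2"
    using zero_le_power2[of "y - 1"] by (simp add: power2_eq_square algebra_simps)
  also have "\<dots> \<le> (real n + 2)\<^sup>2"
    using n b by (intro power_mono) (auto simp: y_def)
  finally have "ln (2 / s) \<le> ln ((real n + 2)\<^sup>2)"
    using b by simp
  then have "ln (2 / s) / 2 \<le> ln (real n + 2)" by (simp add: ln_realpow)
  then have "ln (2 / s) / 2 * (1 / 2) \<le> ln (real n + 2) * r ^ n"
    using n by (intro mult_mono) auto
  then show ?thesis unfolding s_def by auto
qed

section \<open>Comparing the two suprema\<close>

lemma SUP_ennreal_finite_iff:
  fixes f :: "'a \<Rightarrow> real"
  shows "(SUP x\<in>A. ennreal (f x)) < \<infinity> \<longleftrightarrow> (\<exists>M. \<forall>x\<in>A. f x \<le> M)"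
proof
  assume "(SUP x\<in>A. ennreal (f x)) < \<infinity>"
  then obtain M where M: "(SUP x\<in>A. ennreal (f x)) = ennreal M" "0 \<le> M"
    by (cases "SUP x\<in>A. ennreal (f x)") auto
  have "f x \<le> M" if "x \<in> A" for x
  proof -
    have "ennreal (f x) \<le> ennreal M" unfolding M(1)[symmetric] using that by (rule SUP_upper)
    then show ?thesis using M(2) by simp
  qed
  then show "\<exists>M. \<forall>x\<in>A. f x \<le> M" by blast
next
  assume "\<exists>M. \<forall>x\<in>A. f x \<le> M"
  then obtain M where "\<forall>x\<in>A. f x \<le> M" by blast
  then have "(SUP x\<in>A. ennreal (f x)) \<le> ennreal M"
    by (intro SUP_least ennreal_leI) auto
  also have "\<dots> < \<infinity>" by simp
  finally show "(SUP x\<in>A. ennreal (f x)) < \<infinity>" .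
qed

lemma weight_nonneg [simp]: "0 \<le> weight \<beta> z"
  by (simp add: weight_def)

text \<open>
  Both inequalities hold already for each fixed \<open>z\<close>, with \<open>r = |\<phi> z|\<close>, and survive taking suprema
  in either order. As they hold in \<open>[0, \<infinity>]\<close>, what is left of the comparability condition is the
  finiteness of the second quantity.
\<close>

lemma comparable_finite_moments:
  fixes a :: "nat \<Rightarrow> real" and \<omega> :: "real \<Rightarrow> real"
  assumes "0 < c" "0 < C" and nn: "\<And>n. 0 \<le> a n"
    and upper: "\<And>n r. 0 \<le> r \<Longrightarrow> r < 1 \<Longrightarrow> a n * r ^ n \<le> C * \<omega> r"
    and lower: "\<And>r. 0 \<le> r \<Longrightarrow> r < 1 \<Longrightarrow> \<exists>n. c * \<omega> r \<le> a n * r ^ n"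
    and self: "\<phi> ` unit_disc \<subseteq> unit_disc"
  shows "comparable_finite (1 / C) (1 / c)
      (SUP n. ennreal (a n) * weighted_norm \<beta> (\<lambda>z. U z * \<phi> z ^ n))
      (SUP z\<in>unit_disc. ennreal (weight \<beta> z * \<omega> (norm (\<phi> z)) * norm (U z)))
    \<longleftrightarrow> (\<exists>M. \<forall>z\<in>unit_disc. weight \<beta> z * \<omega> (norm (\<phi> z)) * norm (U z) \<le> M)"
    (is "comparable_finite _ _ ?A ?B \<longleftrightarrow> ?bd")
proof -
  have \<phi>1: "norm (\<phi> z) < 1" if "z \<in> unit_disc" for z
    using self that by (force simp: dist_norm)
  define p where "p n z = a n * (weight \<beta> z * norm (U z * \<phi> z ^ n))" for n z
  define q where "q z = weight \<beta> z * \<omega> (norm (\<phi> z)) * norm (U z)" for z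
  have p_eq: "p n z = (weight \<beta> z * norm (U z)) * (a n * norm (\<phi> z) ^ n)" for n z
    by (simp add: p_def norm_mult norm_power)
  have A: "?A = (SUP n. SUP z\<in>unit_disc. ennreal (p n z))"
    using nn by (simp add: weighted_norm_def SUP_mult_left_ennreal p_def ennreal_mult)
  have B: "?B = (SUP z\<in>unit_disc. ennreal (q z))" by (simp add: q_def)
  have le1: "ennreal (1 / C) * ?A \<le> ?B"
    unfolding A B SUP_mult_left_ennreal
  proof (intro SUP_least)
    fix n z assume z: "z \<in> unit_disc"
    have "p n z \<le> (weight \<beta> z * norm (U z)) * (C * \<omega> (norm (\<phi> z)))"
      unfolding p_eq using upper[of "norm (\<phi> z)" n] \<phi>1[OF z] by (intro mult_left_mono) auto
    then have "1 / C * p n z \<le> q z"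
      using \<open>0 < C\<close> by (simp add: q_def field_simps)
    then show "ennreal (1 / C) * ennreal (p n z) \<le> (SUP z\<in>unit_disc. ennreal (q z))"
      using z \<open>0 < C\<close> by (intro SUP_upper2[of z]) (auto simp: ennreal_mult'[symmetric] intro: ennreal_leI)
  qed
  have le2: "?B \<le> ennreal (1 / c) * ?A"
    unfolding A B SUP_mult_left_ennreal
  proof (intro SUP_least)
    fix z assume z: "z \<in> unit_disc"
    obtain n where n: "c * \<omega> (norm (\<phi> z)) \<le> a n * norm (\<phi> z) ^ n"
      using lower[of "norm (\<phi> z)"] \<phi>1[OF z] by auto
    have "(weight \<beta> z * norm (U z)) * (c * \<omega> (norm (\<phi> z))) \<le> p n z"
      unfolding p_eq using n by (intro mult_left_mono) auto
    then have "q z \<le> 1 / c * p n z"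
      using \<open>0 < c\<close> by (simp add: q_def field_simps)
    then show "ennreal (q z) \<le> (SUP n. SUP z\<in>unit_disc. ennreal (1 / c) * ennreal (p n z))"
      using z \<open>0 < c\<close>
      by (intro SUP_upper2[of n] SUP_upper2[of z]) (auto simp: ennreal_mult'[symmetric] intro: ennreal_leI)
  qed
  have "?A < \<infinity>" if "?B < \<infinity>"
  proof -
    have "ennreal (1 / C) * ?A < top" using le1 that by (auto intro: le_less_trans)
    then show ?thesis
      unfolding ennreal_mult_less_top using \<open>0 < C\<close> by (auto simp: ennreal_eq_0_iff)
  qed
  then have "comparable_finite (1 / C) (1 / c) ?A ?B \<longleftrightarrow> ?B < \<infinity>"
    using le1 le2 unfolding comparable_finite_def by blast
  also have "\<dots> \<longleftrightarrow> ?bd" by (rule SUP_ennreal_finite_iff)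
  finally show ?thesis .
qed

section \<open>Zygmund functions and their derivatives\<close>

lemma holomorphic_deriv_disc:
  "f holomorphic_on unit_disc \<Longrightarrow> deriv f holomorphic_on unit_disc"
  by (intro holomorphic_deriv) auto

lemma holomorphic_discI:
  "(\<And>z. z \<in> unit_disc \<Longrightarrow> (f has_field_derivative f' z) (at z)) \<Longrightarrow> f holomorphic_on unit_disc"
  unfolding holomorphic_on_open[OF open_ball] by blast

text \<open>
  Everything the operator sees of a Zygmund function \<open>f\<close> is \<open>f'\<close>, a function of Bloch type. The
  sets below are, up to a factor 2 in the radius, the balls of the Bloch type space; they let the
  growth estimate and the test functions be stated for \<open>h = f'\<close> directly.
\<close>

definition bloch_ball :: "real \<Rightarrow> real \<Rightarrow> (complex \<Rightarrow> complex) set" where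
  "bloch_ball \<alpha> N = {h. h holomorphic_on unit_disc \<and> norm (h 0) \<le> N \<and>
     (\<forall>z\<in>unit_disc. weight \<alpha> z * norm (deriv h z) \<le> N)}"

lemma bloch_ballI:
  "\<lbrakk>h holomorphic_on unit_disc; norm (h 0) \<le> N;
    \<And>z. z \<in> unit_disc \<Longrightarrow> weight \<alpha> z * norm (deriv h z) \<le> N\<rbrakk> \<Longrightarrow> h \<in> bloch_ball \<alpha> N"
  by (simp add: bloch_ball_def)

lemma bloch_ballD:
  assumes "h \<in> bloch_ball \<alpha> N"
  shows "h holomorphic_on unit_disc" "norm (h 0) \<le> N" "0 \<le> N"
    and "z \<in> unit_disc \<Longrightarrow> weight \<alpha> z * norm (deriv h z) \<le> N"
proof -
  show 0: "norm (h 0) \<le> N" using assms by (simp add: bloch_ball_def)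
  show "0 \<le> N" by (rule order.trans[OF norm_ge_zero 0])
qed (use assms in \<open>auto simp: bloch_ball_def\<close>)

lemma bloch_ball_diff:
  assumes h: "h \<in> bloch_ball \<alpha> M" and k: "k \<in> bloch_ball \<alpha> N"
  shows "(\<lambda>z. h z - k z) \<in> bloch_ball \<alpha> (M + N)"
    and "z \<in> unit_disc \<Longrightarrow> deriv (\<lambda>z. h z - k z) z = deriv h z - deriv k z"
proof -
  note h = bloch_ballD[OF h] and k = bloch_ballD[OF k]
  show d: "deriv (\<lambda>z. h z - k z) z = deriv h z - deriv k z" if "z \<in> unit_disc" for z
    using holomorphic_derivI[OF h(1) _ that] holomorphic_derivI[OF k(1) _ that]
    by (intro DERIV_imp_deriv) (auto intro!: derivative_eq_intros)
  show "(\<lambda>z. h z - k z) \<in> bloch_ball \<alpha> (M + N)"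
  proof (rule bloch_ballI)
    show "(\<lambda>z. h z - k z) holomorphic_on unit_disc"
      using h(1) k(1) by (rule holomorphic_on_diff)
    show "norm (h 0 - k 0) \<le> M + N"
      using norm_triangle_ineq4[of "h 0" "k 0"] h(2) k(2) by linarith
    fix z assume z: "z \<in> unit_disc"
    have "weight \<alpha> z * norm (deriv h z - deriv k z) \<le>
        weight \<alpha> z * (norm (deriv h z) + norm (deriv k z))"
      by (intro mult_left_mono norm_triangle_ineq4) simp
    also have "\<dots> \<le> M + N"
      using h(4)[OF z] k(4)[OF z] unfolding distrib_left by linarith
    finally show "weight \<alpha> z * norm (deriv (\<lambda>z. h z - k z) z) \<le> M + N"
      unfolding d[OF z] .
  qed
qed

lemma zygmund_boundsE:
  assumes "f \<in> zygmund \<alpha>"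
  obtains N where "zygmund_norm \<alpha> f = ennreal N" "deriv f \<in> bloch_ball \<alpha> N"
proof -
  have fin: "weighted_norm \<alpha> (deriv (deriv f)) < \<infinity>" and hol: "f holomorphic_on unit_disc"
    using assms by (simp_all add: zygmund_def)
  then obtain M where M: "weighted_norm \<alpha> (deriv (deriv f)) = ennreal M" "0 \<le> M"
    by (cases "weighted_norm \<alpha> (deriv (deriv f))") auto
  have bd: "weight \<alpha> z * norm (deriv (deriv f) z) \<le> M" if "z \<in> unit_disc" for z
  proof -
    have "ennreal (weight \<alpha> z * norm (deriv (deriv f) z)) \<le> ennreal M"
      unfolding M(1)[symmetric] weighted_norm_def using that by (rule SUP_upper)
    then show ?thesis using M(2) by simp
  qed
  show thesis
  proof (rule that[of "norm (f 0) + norm (deriv f 0) + M"])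
    show "zygmund_norm \<alpha> f = ennreal (norm (f 0) + norm (deriv f 0) + M)"
      using M by (simp add: zygmund_norm_def)
    show "deriv f \<in> bloch_ball \<alpha> (norm (f 0) + norm (deriv f 0) + M)"
    proof (rule bloch_ballI)
      show "weight \<alpha> z * norm (deriv (deriv f) z) \<le> norm (f 0) + norm (deriv f 0) + M"
        if "z \<in> unit_disc" for z
        using bd[OF that] by (rule order.trans) auto
    qed (use M holomorphic_deriv_disc[OF hol] in auto)
  qed
qed

lemma zygmund_boundsI:
  assumes "f holomorphic_on unit_disc" "norm (f 0) \<le> a" "norm (deriv f 0) \<le> b"
    and bd: "\<And>z. z \<in> unit_disc \<Longrightarrow> weight \<alpha> z * norm (deriv (deriv f) z) \<le> c"
  shows "f \<in> zygmund \<alpha>" "zygmund_norm \<alpha> f \<le> ennreal (a + b + c)"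
proof -
  have le: "weighted_norm \<alpha> (deriv (deriv f)) \<le> ennreal c"
    unfolding weighted_norm_def using bd by (intro SUP_least ennreal_leI) auto
  then show "f \<in> zygmund \<alpha>"
    using assms(1) by (auto simp: zygmund_def intro: le_less_trans)
  have "0 \<le> c"
    using bd[of 0] by (rule order.trans[rotated]) auto
  moreover have "0 \<le> a" "0 \<le> b" using assms(2,3) norm_ge_zero order.trans by blast+
  moreover have "zygmund_norm \<alpha> f \<le> ennreal a + ennreal b + ennreal c"
    unfolding zygmund_norm_def using assms(2,3) le by (intro add_mono ennreal_leI) auto
  ultimately show "zygmund_norm \<alpha> f \<le> ennreal (a + b + c)" by simp
qed

section \<open>Growth of the derivative of a Zygmund function\<close>

text \<open>
  The largest possible size of \<open>f'\<close> on the circle of radius \<open>r\<close>, up to constants, over the unit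
  ball of the Zygmund type space: the order of growth of 1 plus the integral of \<open>(1 - t\<^sup>2)\<^bsup>-\<alpha>\<^esup>\<close> over \<open>[0, r]\<close>.
\<close>

definition zygmund_growth :: "real \<Rightarrow> real \<Rightarrow> real" where
  "zygmund_growth \<alpha> r =
    (if \<alpha> < 1 then 1 else if \<alpha> = 1 then ln (2 / (1 - r\<^sup>2)) else (1 - r\<^sup>2) powr (1 - \<alpha>))"

lemma zygmund_growth_mono:
  assumes "0 \<le> r" "r \<le> s" "s < 1"
  shows "zygmund_growth \<alpha> r \<le> zygmund_growth \<alpha> s"
proof -
  have "r\<^sup>2 \<le> s\<^sup>2" using assms by (intro power_mono) auto
  moreover have "0 < 1 - s\<^sup>2" using assms one_minus_square_bounds(1)[of s] by auto
  ultimately show ?thesis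
    by (auto simp: zygmund_growth_def intro!: powr_mono2' divide_left_mono)
qed

text \<open>
  A positive lower bound lets the constant term \<open>h 0\<close> be absorbed into a multiple of the growth
  function.
\<close>

lemma zygmund_growth_ge:
  assumes "0 \<le> r" "r < 1"
  shows "ln 2 \<le> zygmund_growth \<alpha> r"
proof -
  have "zygmund_growth \<alpha> 0 \<ge> ln 2" using ln_2_less_1 by (simp add: zygmund_growth_def)
  then show ?thesis using zygmund_growth_mono[of 0 r \<alpha>] assms by linarith
qed

text \<open>
  An explicit primitive of \<open>(1 - t)\<^bsup>-\<alpha>\<^esup>\<close>, which dominates the weight \<open>(1 - t\<^sup>2)\<^bsup>-\<alpha>\<^esup>\<close> and has the same
  order of growth because \<open>1 - t\<close> and \<open>1 - t\<^sup>2\<close> differ by a factor between 1 and 2.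
\<close>

lemma radial_majorant:
  fixes \<alpha> :: real
  assumes "0 < \<alpha>"
  shows "\<exists>\<Phi> K. 0 \<le> K \<and>
    (\<forall>t. 0 \<le> t \<longrightarrow> t < 1 \<longrightarrow> (\<Phi> has_real_derivative (1 - t) powr (- \<alpha>)) (at t)) \<and>
    (\<forall>r. 0 \<le> r \<longrightarrow> r < 1 \<longrightarrow> \<Phi> r - \<Phi> 0 \<le> K * zygmund_growth \<alpha> r)"
proof (cases "\<alpha> = 1")
  case True
  have "((\<lambda>t. - ln (1 - t)) has_real_derivative (1 - t) powr (- \<alpha>)) (at t)" if "0 \<le> t" "t < 1" for t
    using that True by (auto intro!: derivative_eq_intros simp: powr_minus divide_inverse)
  moreover have "- ln (1 - r) - (- ln (1 - 0)) \<le> 1 * zygmund_growth \<alpha> r" if "0 \<le> r" "r < 1" for r :: real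
  proof -
    note b = one_minus_square_bounds[OF that]
    have "- ln (1 - r) = ln (1 / (1 - r))" using that by (simp add: ln_div)
    also have "\<dots> \<le> ln (2 / (1 - r\<^sup>2))"
      using b that by (intro ln_mono) (auto simp: field_simps)
    finally show ?thesis using True by (simp add: zygmund_growth_def)
  qed
  ultimately show ?thesis by (intro exI[of _ "\<lambda>t. - ln (1 - t)"] exI[of _ 1]) auto
next
  case False
  define \<Phi> where "\<Phi> t = (1 - t) powr (1 - \<alpha>) / (\<alpha> - 1)" for t :: real
  have D: "(\<Phi> has_real_derivative (1 - t) powr (- \<alpha>)) (at t)" if "0 \<le> t" "t < 1" for t
  proof -
    have "((\<lambda>t. (1 - t) powr (1 - \<alpha>) / (\<alpha> - 1)) has_real_derivative
        ((1 - \<alpha>) * (1 - t) powr (1 - \<alpha> - 1) * (0 - 1)) / (\<alpha> - 1)) (at t)"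
      using that by (intro DERIV_cdivide DERIV_fun_powr derivative_intros) auto
    moreover have "((1 - \<alpha>) * (1 - t) powr (1 - \<alpha> - 1) * (0 - 1)) / (\<alpha> - 1) = (1 - t) powr (- \<alpha>)"
      using False by (simp add: field_simps)
    ultimately show ?thesis unfolding \<Phi>_def by simp
  qed
  show ?thesis
  proof (cases "\<alpha> < 1")
    case True
    have "\<Phi> r - \<Phi> 0 \<le> 1 / (1 - \<alpha>) * zygmund_growth \<alpha> r" if "0 \<le> r" "r < 1" for r
    proof -
      have "\<Phi> r \<le> 0" using True by (simp add: \<Phi>_def divide_nonneg_neg)
      moreover have "\<Phi> 0 = - (1 / (1 - \<alpha>))" using True by (simp add: \<Phi>_def field_simps)
      ultimately show ?thesis using True by (simp add: zygmund_growth_def)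
    qed
    then show ?thesis using D True by (intro exI[of _ \<Phi>] exI[of _ "1 / (1 - \<alpha>)"]) auto
  next
    case ge: False
    have "\<Phi> r - \<Phi> 0 \<le> 2 powr (\<alpha> - 1) / (\<alpha> - 1) * zygmund_growth \<alpha> r" if "0 \<le> r" "r < 1" for r
    proof -
      note b = one_minus_square_bounds[OF that]
      have "(1 - r) powr (1 - \<alpha>) \<le> ((1 - r\<^sup>2) / 2) powr (1 - \<alpha>)"
        using b ge by (intro powr_mono2') auto
      also have "\<dots> = 2 powr (\<alpha> - 1) * (1 - r\<^sup>2) powr (1 - \<alpha>)"
        using b by (simp add: powr_divide powr_diff field_simps)
      finally have "\<Phi> r \<le> 2 powr (\<alpha> - 1) / (\<alpha> - 1) * (1 - r\<^sup>2) powr (1 - \<alpha>)"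
        using ge False by (simp add: \<Phi>_def divide_right_mono)
      moreover have "0 \<le> \<Phi> 0" using ge by (simp add: \<Phi>_def)
      ultimately show ?thesis using ge False by (simp add: zygmund_growth_def)
    qed
    then show ?thesis using D ge by (intro exI[of _ \<Phi>] exI[of _ "2 powr (\<alpha> - 1) / (\<alpha> - 1)"]) auto
  qed
qed

text \<open>
  Along the radius through \<open>z\<close> the derivative of \<open>h\<close> is at most \<open>N (1 - t)\<^bsup>-\<alpha>\<^esup>\<close>, so the mean value
  inequality compares the increment of \<open>h\<close> with that of the radial majorant.
\<close>

lemma zygmund_deriv_growth:
  assumes "0 < \<alpha>"
  obtains K where "0 \<le> K"
    "\<And>h N z. h \<in> bloch_ball \<alpha> N \<Longrightarrow> z \<in> unit_disc \<Longrightarrow>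
       norm (h z) \<le> K * N * zygmund_growth \<alpha> (norm z)"
proof -
  obtain \<Phi> K where K: "0 \<le> K"
    and D: "\<And>t. 0 \<le> t \<Longrightarrow> t < 1 \<Longrightarrow> (\<Phi> has_real_derivative (1 - t) powr (- \<alpha>)) (at t)"
    and le: "\<And>r. 0 \<le> r \<Longrightarrow> r < 1 \<Longrightarrow> \<Phi> r - \<Phi> 0 \<le> K * zygmund_growth \<alpha> r"
    using radial_majorant[OF assms] by blast
  show thesis
  proof (rule that[of "1 / ln 2 + K"])
    show "0 \<le> 1 / ln 2 + K" using K by simp
  next
    fix h N and z :: complex
    assume "h \<in> bloch_ball \<alpha> N" and z: "z \<in> unit_disc"
    note h = bloch_ballD(1)[OF this(1)] and h0 = bloch_ballD(2)[OF this(1)]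
      and N = bloch_ballD(3)[OF this(1)] and bd = bloch_ballD(4)[OF this(1)]
    define r where "r = norm z"
    have r: "0 \<le> r" "r < 1" using z by (auto simp: r_def)
    have radial: "norm (h z - h 0) \<le> N * (\<Phi> r - \<Phi> 0)"
    proof (cases "r = 0")
      case True
      then show ?thesis by (simp add: r_def)
    next
      case False
      define e where "e = z / of_real r"
      have e: "norm e = 1" "z = of_real r * e"
        using False by (auto simp: e_def r_def norm_divide)
      have in_disc: "of_real t * e \<in> unit_disc" if "0 \<le> t" "t \<le> r" for t
        using that r e by (simp add: norm_mult)
      have vd: "((\<lambda>t. h (of_real t * e)) has_vector_derivative (e * deriv h (of_real t * e))) (at t)"
        if "0 \<le> t" "t \<le> r" for t
      proof -
        have "(h has_field_derivative deriv h (of_real t * e)) (at (of_real t * e))"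
          using holomorphic_derivI[OF h _ in_disc[OF that]] by auto
        moreover have "((\<lambda>t. of_real t * e) has_vector_derivative e) (at t)"
          by (auto intro!: derivative_eq_intros has_vector_derivative_mult_left
              has_vector_derivative_of_real simp: has_vector_derivative_def scaleR_conv_of_real)
        ultimately show ?thesis
          using field_vector_diff_chain_at[of "\<lambda>t. of_real t * e" e t h] by (simp add: o_def)
      qed
      have "norm (h (of_real r * e) - h (of_real 0 * e)) \<le> N * \<Phi> r - N * \<Phi> 0"
      proof (rule differentiable_bound_general[where f = "\<lambda>t. h (of_real t * e)"
            and f' = "\<lambda>t. e * deriv h (of_real t * e)" and \<phi> = "\<lambda>t. N * \<Phi> t"
            and \<phi>' = "\<lambda>t. N * (1 - t) powr (- \<alpha>)"])
        show "0 < r" using False r by simp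
        show "continuous_on {0..r} (\<lambda>t. h (of_real t * e))"
          using has_vector_derivative_continuous[OF vd]
          by (intro continuous_at_imp_continuous_on) simp
        show "continuous_on {0..r} (\<lambda>t. N * \<Phi> t)"
        proof (intro continuous_at_imp_continuous_on ballI)
          fix t assume "t \<in> {0..r}"
          then have "isCont \<Phi> t" using D[of t] r by (intro DERIV_isCont) auto
          then show "isCont (\<lambda>t. N * \<Phi> t) t" by (intro continuous_intros)
        qed
        fix t assume t: "0 < t" "t < r"
        show "((\<lambda>t. h (of_real t * e)) has_vector_derivative e * deriv h (of_real t * e)) (at t)"
          using vd t by simp
        show "((\<lambda>t. N * \<Phi> t) has_vector_derivative N * (1 - t) powr (- \<alpha>)) (at t)"
          using D[of t] t r
          by (auto intro!: DERIV_cmult simp: has_real_derivative_iff_has_vector_derivative[symmetric])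
        have tt: "0 < 1 - t\<^sup>2" "1 - t \<le> 1 - t\<^sup>2"
          using one_minus_square_bounds[of t] t r
          by (auto simp: power2_eq_square mult_left_le_one_le)
        have "(1 - t\<^sup>2) powr \<alpha> * norm (deriv h (of_real t * e)) \<le> N"
          using bd[OF in_disc[of t]] t e by (simp add: weight_def norm_mult)
        then have "norm (deriv h (of_real t * e)) \<le> N * (1 - t\<^sup>2) powr (- \<alpha>)"
          using tt by (simp add: powr_minus field_simps)
        also have "\<dots> \<le> N * (1 - t) powr (- \<alpha>)"
          using N tt t r assms by (intro mult_left_mono powr_mono2') auto
        finally show "norm (e * deriv h (of_real t * e)) \<le> N * (1 - t) powr (- \<alpha>)"
          by (simp add: norm_mult e)
      qed
      then show ?thesis using e by (simp add: algebra_simps)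
    qed
    have "1 * ln 2 \<le> zygmund_growth \<alpha> r" using zygmund_growth_ge[OF r] by simp
    then have "1 \<le> zygmund_growth \<alpha> r / ln 2" by (simp add: field_simps)
    then have h0': "norm (h 0) \<le> N * (zygmund_growth \<alpha> r / ln 2)"
      using h0 N mult_left_mono[of 1 "zygmund_growth \<alpha> r / ln 2" N] by simp
    have "norm (h z) \<le> norm (h 0) + norm (h z - h 0)"
      using norm_triangle_ineq[of "h 0" "h z - h 0"] by simp
    also have "\<dots> \<le> N * (zygmund_growth \<alpha> r / ln 2) + N * (K * zygmund_growth \<alpha> r)"
      using h0' radial mult_left_mono[OF le[OF r] N] by linarith
    also have "\<dots> = (1 / ln 2 + K) * N * zygmund_growth \<alpha> r"
      by (simp add: algebra_simps)
    finally show "norm (h z) \<le> (1 / ln 2 + K) * N * zygmund_growth \<alpha> (norm z)"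
      unfolding r_def .
  qed
qed

section \<open>The second derivative of the image function\<close>

text \<open>
  The functions \<open>u\<close> and \<open>w\<close>: the coefficients of \<open>f'' \<circ> \<phi>\<close> and of \<open>f' \<circ> \<phi>\<close> in \<open>(CV \<phi> g f)''\<close>.
\<close>

definition cv_coeff2 :: "(complex \<Rightarrow> complex) \<Rightarrow> (complex \<Rightarrow> complex) \<Rightarrow> complex \<Rightarrow> complex" where
  "cv_coeff2 \<phi> g z = g (\<phi> z) * (deriv \<phi> z)\<^sup>2"

definition cv_coeff1 :: "(complex \<Rightarrow> complex) \<Rightarrow> (complex \<Rightarrow> complex) \<Rightarrow> complex \<Rightarrow> complex" where
  "cv_coeff1 \<phi> g z = deriv g (\<phi> z) * (deriv \<phi> z)\<^sup>2 + g (\<phi> z) * deriv (deriv \<phi>) z"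

text \<open>
  The disc is convex, so \<open>f' g\<close> has a primitive there; every analytic property of the operator is
  read off from this representation.
\<close>

lemma CV_eq_primitive:
  assumes \<phi>: "\<phi> ` unit_disc \<subseteq> unit_disc"
    and g: "g holomorphic_on unit_disc" and f: "f holomorphic_on unit_disc"
  obtains F where "\<And>x. x \<in> unit_disc \<Longrightarrow> (F has_field_derivative deriv f x * g x) (at x)"
    "\<And>z. z \<in> unit_disc \<Longrightarrow>
      ((\<lambda>\<xi>. deriv f \<xi> * g \<xi>) has_contour_integral (F (\<phi> z) - F 0)) (linepath 0 (\<phi> z))"
    "\<And>z. z \<in> unit_disc \<Longrightarrow> CV \<phi> g f z = F (\<phi> z) - F 0"
proof -
  have "(\<lambda>\<xi>. deriv f \<xi> * g \<xi>) holomorphic_on unit_disc"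
    using holomorphic_deriv_disc[OF f] g by (intro holomorphic_on_mult)
  then obtain F where F: "\<And>x. x \<in> unit_disc \<Longrightarrow>
      (F has_field_derivative deriv f x * g x) (at x within unit_disc)"
    using holomorphic_convex_primitive'[of unit_disc] by auto
  have int: "((\<lambda>\<xi>. deriv f \<xi> * g \<xi>) has_contour_integral (F (\<phi> z) - F 0)) (linepath 0 (\<phi> z))"
    if "z \<in> unit_disc" for z
  proof -
    have "\<phi> z \<in> unit_disc" using \<phi> that by blast
    then have "closed_segment 0 (\<phi> z) \<subseteq> unit_disc"
      by (intro closed_segment_subset) auto
    then show ?thesis
      using contour_integral_primitive[OF F, where g = "linepath 0 (\<phi> z)"] by auto
  qed
  show thesis
  proof (rule that[of F])
    show "(F has_field_derivative deriv f x * g x) (at x)" if "x \<in> unit_disc" for x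
      using F[OF that] at_within_open[OF that] by simp
    show "CV \<phi> g f z = F (\<phi> z) - F 0" if "z \<in> unit_disc" for z
      unfolding CV_def by (rule contour_integral_unique[OF int[OF that]])
  qed (use int in auto)
qed

lemma CV_derivatives:
  assumes h\<phi>: "\<phi> holomorphic_on unit_disc" and \<phi>: "\<phi> ` unit_disc \<subseteq> unit_disc"
    and g: "g holomorphic_on unit_disc" and f: "f holomorphic_on unit_disc"
  shows "CV \<phi> g f holomorphic_on unit_disc"
    and "z \<in> unit_disc \<Longrightarrow> deriv (CV \<phi> g f) z = deriv f (\<phi> z) * g (\<phi> z) * deriv \<phi> z"
    and "z \<in> unit_disc \<Longrightarrow> deriv (deriv (CV \<phi> g f)) z =
      deriv (deriv f) (\<phi> z) * cv_coeff2 \<phi> g z + deriv f (\<phi> z) * cv_coeff1 \<phi> g z"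
proof -
  obtain F where F: "\<And>x. x \<in> unit_disc \<Longrightarrow> (F has_field_derivative deriv f x * g x) (at x)"
    and "\<And>z. z \<in> unit_disc \<Longrightarrow>
      ((\<lambda>\<xi>. deriv f \<xi> * g \<xi>) has_contour_integral (F (\<phi> z) - F 0)) (linepath 0 (\<phi> z))"
    and CV: "\<And>z. z \<in> unit_disc \<Longrightarrow> CV \<phi> g f z = F (\<phi> z) - F 0"
    using that by (rule CV_eq_primitive[OF \<phi> g f])
  have in_disc: "\<phi> z \<in> unit_disc" if "z \<in> unit_disc" for z using \<phi> that by blast
  have D\<phi>: "(\<phi> has_field_derivative deriv \<phi> z) (at z)" if "z \<in> unit_disc" for z
    using holomorphic_derivI[OF h\<phi> _ that] by auto
  have D: "(CV \<phi> g f has_field_derivative deriv f (\<phi> z) * g (\<phi> z) * deriv \<phi> z) (at z)"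
    if "z \<in> unit_disc" for z
  proof -
    have "((\<lambda>z. F (\<phi> z) - F 0) has_field_derivative deriv f (\<phi> z) * g (\<phi> z) * deriv \<phi> z) (at z)"
      using DERIV_chain2[OF F[OF in_disc[OF that]] D\<phi>[OF that]]
      by (auto intro!: derivative_eq_intros)
    then show ?thesis
      by (rule has_field_derivative_transform_within_open[of _ _ _ unit_disc]) (use that CV in auto)
  qed
  then show "CV \<phi> g f holomorphic_on unit_disc"
    by (rule holomorphic_discI)
  show D1: "deriv (CV \<phi> g f) z = deriv f (\<phi> z) * g (\<phi> z) * deriv \<phi> z" if "z \<in> unit_disc" for z
    using D[OF that] by (rule DERIV_imp_deriv)
  assume z: "z \<in> unit_disc"
  have Df: "(deriv f has_field_derivative deriv (deriv f) (\<phi> z)) (at (\<phi> z))"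
    using holomorphic_derivI[OF holomorphic_deriv_disc[OF f] _ in_disc[OF z]] by auto
  have Dg: "(g has_field_derivative deriv g (\<phi> z)) (at (\<phi> z))"
    using holomorphic_derivI[OF g _ in_disc[OF z]] by auto
  have DD\<phi>: "(deriv \<phi> has_field_derivative deriv (deriv \<phi>) z) (at z)"
    using holomorphic_derivI[OF holomorphic_deriv_disc[OF h\<phi>] _ z] by auto
  have "((\<lambda>z. deriv f (\<phi> z) * g (\<phi> z) * deriv \<phi> z) has_field_derivative
      (deriv (deriv f) (\<phi> z) * cv_coeff2 \<phi> g z + deriv f (\<phi> z) * cv_coeff1 \<phi> g z)) (at z)"
    by (rule derivative_eq_intros DERIV_chain2[OF Df D\<phi>[OF z]] DERIV_chain2[OF Dg D\<phi>[OF z]] DD\<phi> refl)+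
      (simp add: cv_coeff2_def cv_coeff1_def power2_eq_square algebra_simps)
  then have "(deriv (CV \<phi> g f) has_field_derivative
      (deriv (deriv f) (\<phi> z) * cv_coeff2 \<phi> g z + deriv f (\<phi> z) * cv_coeff1 \<phi> g z)) (at z)"
    by (rule has_field_derivative_transform_within_open[of _ _ _ unit_disc]) (use z D1 in auto)
  then show "deriv (deriv (CV \<phi> g f)) z =
      deriv (deriv f) (\<phi> z) * cv_coeff2 \<phi> g z + deriv f (\<phi> z) * cv_coeff1 \<phi> g z"
    by (rule DERIV_imp_deriv)
qed

lemma CV_linear:
  assumes \<phi>: "\<phi> ` unit_disc \<subseteq> unit_disc" and g: "g holomorphic_on unit_disc"
    and f: "f holomorphic_on unit_disc" and h: "h holomorphic_on unit_disc" and z: "z \<in> unit_disc"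
  shows "CV \<phi> g (\<lambda>w. a * f w + b * h w) z = a * CV \<phi> g f z + b * CV \<phi> g h z"
proof -
  obtain F where "\<And>x. x \<in> unit_disc \<Longrightarrow> (F has_field_derivative deriv f x * g x) (at x)"
    and F: "\<And>z. z \<in> unit_disc \<Longrightarrow>
      ((\<lambda>\<xi>. deriv f \<xi> * g \<xi>) has_contour_integral (F (\<phi> z) - F 0)) (linepath 0 (\<phi> z))"
    and CF: "\<And>z. z \<in> unit_disc \<Longrightarrow> CV \<phi> g f z = F (\<phi> z) - F 0"
    using that by (rule CV_eq_primitive[OF \<phi> g f])
  obtain H where "\<And>x. x \<in> unit_disc \<Longrightarrow> (H has_field_derivative deriv h x * g x) (at x)"
    and H: "\<And>z. z \<in> unit_disc \<Longrightarrow>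
      ((\<lambda>\<xi>. deriv h \<xi> * g \<xi>) has_contour_integral (H (\<phi> z) - H 0)) (linepath 0 (\<phi> z))"
    and CH: "\<And>z. z \<in> unit_disc \<Longrightarrow> CV \<phi> g h z = H (\<phi> z) - H 0"
    using that by (rule CV_eq_primitive[OF \<phi> g h])
  have d: "deriv (\<lambda>w. a * f w + b * h w) \<xi> = a * deriv f \<xi> + b * deriv h \<xi>"
    if "\<xi> \<in> unit_disc" for \<xi>
    using holomorphic_derivI[OF f _ that] holomorphic_derivI[OF h _ that]
    by (intro DERIV_imp_deriv) (auto intro!: derivative_eq_intros)
  have "\<phi> z \<in> unit_disc" using \<phi> z by blast
  then have seg: "closed_segment 0 (\<phi> z) \<subseteq> unit_disc"
    by (intro closed_segment_subset) auto
  have "((\<lambda>\<xi>. a * (deriv f \<xi> * g \<xi>) + b * (deriv h \<xi> * g \<xi>)) has_contour_integral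
      (a * (F (\<phi> z) - F 0) + b * (H (\<phi> z) - H 0))) (linepath 0 (\<phi> z))"
    using F[OF z] H[OF z] by (intro has_contour_integral_add has_contour_integral_lmul)
  then have "((\<lambda>\<xi>. deriv (\<lambda>w. a * f w + b * h w) \<xi> * g \<xi>) has_contour_integral
      (a * (F (\<phi> z) - F 0) + b * (H (\<phi> z) - H 0))) (linepath 0 (\<phi> z))"
    by (rule has_contour_integral_eq) (use seg d in \<open>auto simp: algebra_simps\<close>)
  then show ?thesis
    unfolding CF[OF z] CH[OF z] by (subst CV_def) (rule contour_integral_unique)
qed

section \<open>Sufficiency\<close>

text \<open>
  The second derivative is estimated by its formula. The values at 0 need constants that may depend
  on \<open>\<phi>\<close> and \<open>g\<close>: \<open>g\<close> is bounded on the segment from 0 to \<open>\<phi> 0\<close>, and \<open>f'\<close> is bounded there by its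
  growth at the endpoint.
\<close>

lemma CV_bounded_if_coeff_bounds:
  assumes "0 < \<alpha>"
    and h\<phi>: "\<phi> holomorphic_on unit_disc" and \<phi>: "\<phi> ` unit_disc \<subseteq> unit_disc"
    and g: "g holomorphic_on unit_disc"
    and M2: "\<And>z. z \<in> unit_disc \<Longrightarrow>
      weight \<beta> z * (1 - (norm (\<phi> z))\<^sup>2) powr (- \<alpha>) * norm (cv_coeff2 \<phi> g z) \<le> M2"
    and M1: "\<And>z. z \<in> unit_disc \<Longrightarrow>
      weight \<beta> z * zygmund_growth \<alpha> (norm (\<phi> z)) * norm (cv_coeff1 \<phi> g z) \<le> M1"
  shows "bounded_zygmund_operator \<alpha> \<beta> (CV \<phi> g)"
proof -
  obtain K where K: "0 \<le> K"
    and growth: "\<And>h N z. h \<in> bloch_ball \<alpha> N \<Longrightarrow> z \<in> unit_disc \<Longrightarrow>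
       norm (h z) \<le> K * N * zygmund_growth \<alpha> (norm z)"
    using zygmund_deriv_growth[OF assms(1)] by blast
  have in_disc: "\<phi> z \<in> unit_disc" if "z \<in> unit_disc" for z using \<phi> that by blast
  have \<phi>1: "norm (\<phi> z) < 1" if "z \<in> unit_disc" for z using in_disc[OF that] by simp
  define G where "G = zygmund_growth \<alpha> (norm (\<phi> 0))"
  have G: "0 \<le> G"
    using zygmund_growth_ge[of "norm (\<phi> 0)" \<alpha>] \<phi>1[of 0] by (simp add: G_def order.trans[of 0 "ln 2"])
  have seg: "closed_segment 0 (\<phi> 0) \<subseteq> unit_disc"
    using in_disc[of 0] by (intro closed_segment_subset) auto
  have "continuous_on (closed_segment 0 (\<phi> 0)) g"
    using g seg holomorphic_on_imp_continuous_on continuous_on_subset by blast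
  then have "bounded (g ` closed_segment 0 (\<phi> 0))"
    by (intro compact_imp_bounded compact_continuous_image) auto
  then obtain B where B: "0 < B" "\<And>\<xi>. \<xi> \<in> closed_segment 0 (\<phi> 0) \<Longrightarrow> norm (g \<xi>) \<le> B"
    by (auto simp: bounded_pos)
  define C0 where "C0 = K * G * B * norm (\<phi> 0)"
  define C1 where "C1 = K * G * (norm (g (\<phi> 0)) * norm (deriv \<phi> 0))"
  define C2 where "C2 = M2 + K * M1"
  have key: "CV \<phi> g f \<in> zygmund \<beta> \<and>
      zygmund_norm \<beta> (CV \<phi> g f) \<le> ennreal (C0 + C1 + C2) * zygmund_norm \<alpha> f"
    if f: "f \<in> zygmund \<alpha>" for f
  proof -
    have hf: "f holomorphic_on unit_disc" using f by (simp add: zygmund_def)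
    obtain N where fN: "zygmund_norm \<alpha> f = ennreal N" and df: "deriv f \<in> bloch_ball \<alpha> N"
      using that by (rule zygmund_boundsE[OF f])
    note N = bloch_ballD(3)[OF df] and N2 = bloch_ballD(4)[OF df] and gr = growth[OF df]
    note D = CV_derivatives[OF h\<phi> \<phi> g hf]
    have b0: "norm (CV \<phi> g f 0) \<le> C0 * N"
    proof -
      have "norm (deriv f \<xi> * g \<xi>) \<le> K * N * G * B" if \<xi>: "\<xi> \<in> closed_segment 0 (\<phi> 0)" for \<xi>
      proof -
        have "norm \<xi> \<le> norm (\<phi> 0)" using segment_bound(1)[OF \<xi>] by simp
        then have "zygmund_growth \<alpha> (norm \<xi>) \<le> G"
          unfolding G_def using \<phi>1[of 0] by (intro zygmund_growth_mono) auto
        then have "K * N * zygmund_growth \<alpha> (norm \<xi>) \<le> K * N * G"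
          using K N by (intro mult_left_mono) auto
        then have "norm (deriv f \<xi>) \<le> K * N * G" using gr[of \<xi>] seg \<xi> by force
        then show ?thesis
          unfolding norm_mult using B \<xi> K N G by (intro mult_mono) auto
      qed
      moreover obtain F where "((\<lambda>\<xi>. deriv f \<xi> * g \<xi>) has_contour_integral (F (\<phi> 0) - F 0)) (linepath 0 (\<phi> 0))"
        using CV_eq_primitive[OF \<phi> g hf] by (metis centre_in_ball zero_less_one)
      ultimately have "norm (CV \<phi> g f 0) \<le> K * N * G * B * norm (\<phi> 0 - 0)"
        unfolding CV_def using K N G B
        by (intro contour_integral_bound_linepath) (auto simp: contour_integrable_on_def)
      then show ?thesis by (simp add: C0_def mult_ac)
    qed
    have b1: "norm (deriv (CV \<phi> g f) 0) \<le> C1 * N"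
    proof -
      have "norm (deriv (CV \<phi> g f) 0) = norm (deriv f (\<phi> 0)) * (norm (g (\<phi> 0)) * norm (deriv \<phi> 0))"
        by (simp add: D(2) norm_mult)
      also have "\<dots> \<le> (K * N * G) * (norm (g (\<phi> 0)) * norm (deriv \<phi> 0))"
        unfolding G_def using gr[OF in_disc[of 0]] by (intro mult_right_mono) auto
      finally show ?thesis by (simp add: C1_def mult_ac)
    qed
    have b2: "weight \<beta> z * norm (deriv (deriv (CV \<phi> g f)) z) \<le> C2 * N" if z: "z \<in> unit_disc" for z
    proof -
      let ?s = "1 - (norm (\<phi> z))\<^sup>2"
      let ?u = "norm (cv_coeff2 \<phi> g z)" and ?w = "norm (cv_coeff1 \<phi> g z)"
      have s: "0 < ?s" using \<phi>1[OF z] by (simp add: abs_square_less_1)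
      have d2: "norm (deriv (deriv f) (\<phi> z)) \<le> N * ?s powr (- \<alpha>)"
        using N2[OF in_disc[OF z]] s by (simp add: weight_def powr_minus field_simps)
      have d1: "norm (deriv f (\<phi> z)) \<le> K * N * zygmund_growth \<alpha> (norm (\<phi> z))"
        using gr[OF in_disc[OF z]] .
      have "norm (deriv (deriv (CV \<phi> g f)) z) \<le>
          norm (deriv (deriv f) (\<phi> z)) * ?u + norm (deriv f (\<phi> z)) * ?w"
        unfolding D(3)[OF z] by (metis norm_mult norm_triangle_ineq)
      also have "\<dots> \<le> N * ?s powr (- \<alpha>) * ?u + K * N * zygmund_growth \<alpha> (norm (\<phi> z)) * ?w"
        using d1 d2 by (intro add_mono mult_right_mono) auto
      finally have "weight \<beta> z * norm (deriv (deriv (CV \<phi> g f)) z) \<le>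
          weight \<beta> z * (N * ?s powr (- \<alpha>) * ?u + K * N * zygmund_growth \<alpha> (norm (\<phi> z)) * ?w)"
        by (intro mult_left_mono) auto
      also have "\<dots> = N * (weight \<beta> z * ?s powr (- \<alpha>) * ?u) +
          K * N * (weight \<beta> z * zygmund_growth \<alpha> (norm (\<phi> z)) * ?w)"
        by (simp add: algebra_simps)
      also have "\<dots> \<le> N * M2 + K * N * M1"
        using M1[OF z] M2[OF z] K N by (intro add_mono mult_left_mono) auto
      finally show ?thesis by (simp add: C2_def algebra_simps)
    qed
    have I: "CV \<phi> g f \<in> zygmund \<beta>" "zygmund_norm \<beta> (CV \<phi> g f) \<le> ennreal (C0 * N + C1 * N + C2 * N)"
      using zygmund_boundsI[OF D(1) b0 b1] b2 by blast+
    have "C0 * N + C1 * N + C2 * N = (C0 + C1 + C2) * N" by (simp add: algebra_simps)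
    then show ?thesis using I N by (simp add: fN ennreal_mult'')
  qed
  have "0 \<le> M2" using M2[of 0] by (rule order.trans[rotated]) auto
  moreover have "0 \<le> M1"
    using M1[of 0] zygmund_growth_ge[of "norm (\<phi> 0)" \<alpha>] \<phi>1[of 0]
    by (intro order.trans[OF _ M1[of 0]]) (auto intro!: mult_nonneg_nonneg simp: order.trans[of 0 "ln 2"])
  ultimately have "0 \<le> C0 + C1 + C2"
    using K G B by (auto simp: C0_def C1_def C2_def)
  then show ?thesis
    unfolding bounded_zygmund_operator_def using key CV_linear[OF \<phi> g]
    by (auto simp: zygmund_def)
qed

section \<open>Necessity\<close>

text \<open>
  Every \<open>h\<close> of Bloch type is the derivative of a Zygmund function, so boundedness may be tested on
  \<open>h\<close>. The factor 2 lost in passing from \<open>h\<close> to its primitive goes into \<open>C\<close>.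
\<close>

lemma bounded_CV_test:
  assumes bdd: "bounded_zygmund_operator \<alpha> \<beta> (CV \<phi> g)"
    and h\<phi>: "\<phi> holomorphic_on unit_disc" and \<phi>: "\<phi> ` unit_disc \<subseteq> unit_disc"
    and g: "g holomorphic_on unit_disc"
  obtains C where "0 \<le> C"
    "\<And>h N z. h \<in> bloch_ball \<alpha> N \<Longrightarrow> z \<in> unit_disc \<Longrightarrow>
      weight \<beta> z * norm (deriv h (\<phi> z) * cv_coeff2 \<phi> g z + h (\<phi> z) * cv_coeff1 \<phi> g z) \<le> C * N"
proof -
  obtain C where C: "0 \<le> C"
    "\<And>f. f \<in> zygmund \<alpha> \<Longrightarrow> CV \<phi> g f \<in> zygmund \<beta>"
    "\<And>f. f \<in> zygmund \<alpha> \<Longrightarrow> zygmund_norm \<beta> (CV \<phi> g f) \<le> ennreal C * zygmund_norm \<alpha> f"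
    using bdd unfolding bounded_zygmund_operator_def by blast
  show thesis
  proof (rule that[of "2 * C"])
    show "0 \<le> 2 * C" using C by simp
  next
    fix h N and z :: complex
    assume "h \<in> bloch_ball \<alpha> N" and z: "z \<in> unit_disc"
    note h = bloch_ballD(1)[OF this(1)] and h0 = bloch_ballD(2)[OF this(1)]
      and N = bloch_ballD(3)[OF this(1)] and h1 = bloch_ballD(4)[OF this(1)]
    obtain F where F: "\<And>x. x \<in> unit_disc \<Longrightarrow> (F has_field_derivative h x) (at x within unit_disc)"
      using holomorphic_convex_primitive'[OF _ _ h] by auto
    define f where "f x = F x - F 0" for x
    have Df: "(f has_field_derivative h x) (at x)" if "x \<in> unit_disc" for x
      using F[OF that] at_within_open[OF that] unfolding f_def
      by (auto intro!: derivative_eq_intros)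
    then have hf: "f holomorphic_on unit_disc" by (rule holomorphic_discI)
    have d1: "deriv f x = h x" if "x \<in> unit_disc" for x
      using Df[OF that] by (rule DERIV_imp_deriv)
    have d2: "deriv (deriv f) x = deriv h x" if "x \<in> unit_disc" for x
      using that d1 h holomorphic_deriv_disc[OF hf]
      by (intro complex_derivative_transform_within_open[of _ unit_disc]) auto
    have f: "f \<in> zygmund \<alpha>" "zygmund_norm \<alpha> f \<le> ennreal (0 + N + N)"
      using zygmund_boundsI[OF hf, of 0 N \<alpha> N] h0 h1 d1 d2 by (auto simp: f_def)
    obtain N' where N': "zygmund_norm \<beta> (CV \<phi> g f) = ennreal N'"
      and dT: "deriv (CV \<phi> g f) \<in> bloch_ball \<beta> N'"
      using that by (rule zygmund_boundsE[OF C(2)[OF f(1)]])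
    have "ennreal N' \<le> ennreal C * zygmund_norm \<alpha> f"
      unfolding N'[symmetric] by (rule C(3)[OF f(1)])
    also have "\<dots> \<le> ennreal C * ennreal (0 + N + N)"
      using f(2) by (intro mult_left_mono) auto
    also have "\<dots> = ennreal (C * (N + N))"
      using C N by (simp add: ennreal_mult)
    finally have "N' \<le> C * (N + N)" using C N by simp
    moreover have "\<phi> z \<in> unit_disc" using \<phi> z by blast
    ultimately show "weight \<beta> z * norm (deriv h (\<phi> z) * cv_coeff2 \<phi> g z + h (\<phi> z) * cv_coeff1 \<phi> g z)
        \<le> 2 * C * N"
      using bloch_ballD(4)[OF dT z] CV_derivatives(3)[OF h\<phi> \<phi> g hf z] d1 d2 by (simp add: algebra_simps)
  qed
qed

text \<open>
  The kernel denominator dominates the distance to the boundary of both of its arguments. This is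
  what makes the normalized kernels uniformly bounded in the Bloch type norm.
\<close>

lemma one_minus_cnj_mult_lower:
  assumes "a \<in> unit_disc" "z \<in> unit_disc"
  shows "0 < norm (1 - cnj a * z)"
    and "1 - (norm a)\<^sup>2 \<le> 2 * norm (1 - cnj a * z)" "1 - (norm z)\<^sup>2 \<le> 2 * norm (1 - cnj a * z)"
proof -
  have az: "norm a < 1" "norm z < 1" using assms by auto
  have "1 - norm a * norm z \<le> norm (1 - cnj a * z)"
    using norm_triangle_ineq2[of 1 "cnj a * z"] by (simp add: norm_mult)
  moreover have "norm a * norm z \<le> norm a" "norm a * norm z \<le> norm z"
    using az by (auto intro: mult_left_le mult_left_le_one_le)
  ultimately have d: "1 - norm a \<le> norm (1 - cnj a * z)" "1 - norm z \<le> norm (1 - cnj a * z)"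
    by linarith+
  then show "1 - (norm a)\<^sup>2 \<le> 2 * norm (1 - cnj a * z)" "1 - (norm z)\<^sup>2 \<le> 2 * norm (1 - cnj a * z)"
    using one_minus_square_bounds(3)[of "norm a"] one_minus_square_bounds(3)[of "norm z"] az
    by auto
  show "0 < norm (1 - cnj a * z)" using d az by linarith
qed

text \<open>
  A power of the Cauchy kernel, normalized so that at \<open>z = a\<close> it equals \<open>(1 - |a|\<^sup>2)\<^bsup>1-\<alpha>\<^esup>\<close> for every
  \<open>N\<close>, while its derivative there is proportional to \<open>N\<close>. Placing the real exponent on
  \<open>1 - |a|\<^sup>2\<close> keeps the complex power an integer one.
\<close>

definition disc_kernel :: "real \<Rightarrow> nat \<Rightarrow> complex \<Rightarrow> complex \<Rightarrow> complex" where
  "disc_kernel \<alpha> N a z =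
    of_real ((1 - (norm a)\<^sup>2) powr (real N + 1 - \<alpha>)) / (1 - cnj a * z) ^ N"

lemma disc_kernel_deriv:
  assumes "a \<in> unit_disc" "z \<in> unit_disc"
  shows "(disc_kernel \<alpha> N a has_field_derivative
    of_nat N * cnj a * of_real ((1 - (norm a)\<^sup>2) powr (real N + 1 - \<alpha>)) / (1 - cnj a * z) ^ (N + 1)) (at z)"
proof -
  define p where "p = 1 - cnj a * z"
  define c where "c = complex_of_real ((1 - (norm a)\<^sup>2) powr (real N + 1 - \<alpha>))"
  have p: "p \<noteq> 0" using one_minus_cnj_mult_lower(1)[OF assms] by (auto simp: p_def)
  have "((\<lambda>z. c / (1 - cnj a * z) ^ N) has_field_derivative of_nat N * cnj a * c / p ^ (N + 1)) (at z)"
  proof (cases N)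
    case (Suc n)
    have "((\<lambda>z. c / (1 - cnj a * z) ^ Suc n) has_field_derivative
        (0 * p ^ Suc n - c * (of_nat (Suc n) * (0 - cnj a) * p ^ n)) / (p ^ Suc n * p ^ Suc n)) (at z)"
      using p unfolding p_def by (auto intro!: derivative_eq_intros simp del: power_Suc)
    moreover have "(0 * p ^ Suc n - c * (of_nat (Suc n) * (0 - cnj a) * p ^ n)) / (p ^ Suc n * p ^ Suc n) =
        of_nat (Suc n) * cnj a * c / p ^ (Suc n + 1)"
      using p by (simp add: divide_simps del: of_nat_Suc)
    ultimately show ?thesis unfolding Suc by simp
  qed simp
  then show ?thesis by (simp add: disc_kernel_def[abs_def] c_def p_def)
qed

lemma one_minus_cnj_mult_self: "1 - cnj a * a = complex_of_real (1 - (norm a)\<^sup>2)"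
  using complex_norm_square[of a] by (simp add: mult.commute)

text \<open>
  For the Bloch bound the numerator and the weight together carry the total exponent \<open>N + 1\<close>, which
  is exactly that of the denominator in the derivative; \<open>\<alpha> \<le> N + 1\<close> makes both exponents nonnegative.
\<close>

lemma disc_kernel_test:
  assumes a: "a \<in> unit_disc" and \<alpha>: "0 < \<alpha>" "\<alpha> \<le> real N + 1"
  shows "disc_kernel \<alpha> N a \<in> bloch_ball \<alpha> (1 + real N * 2 ^ (N + 1))"
    and "disc_kernel \<alpha> N a a = of_real ((1 - (norm a)\<^sup>2) powr (1 - \<alpha>))"
    and "deriv (disc_kernel \<alpha> N a) a = of_nat N * cnj a * of_real ((1 - (norm a)\<^sup>2) powr (- \<alpha>))"
proof -
  define s where "s = 1 - (norm a)\<^sup>2"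
  have s: "0 < s" "s \<le> 1"
    using one_minus_square_bounds[of "norm a"] a by (auto simp: s_def)
  note D = disc_kernel_deriv[OF a, of _ \<alpha> N, folded s_def]
  have aa: "1 - cnj a * a = of_real s"
    unfolding s_def by (rule one_minus_cnj_mult_self)
  have pw: "s powr (x - real m) = s powr x / s ^ m" for x m
    unfolding powr_diff powr_realpow[OF s(1)] ..
  show "disc_kernel \<alpha> N a a = of_real ((1 - (norm a)\<^sup>2) powr (1 - \<alpha>))"
    using pw[of "real N + 1 - \<alpha>" N] by (simp add: disc_kernel_def aa flip: s_def)
  show "deriv (disc_kernel \<alpha> N a) a = of_nat N * cnj a * of_real ((1 - (norm a)\<^sup>2) powr (- \<alpha>))"
    using pw[of "real N + 1 - \<alpha>" "N + 1"] DERIV_imp_deriv[OF D[OF a]]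
    by (simp add: aa del: power_Suc flip: s_def)
  have bd: "weight \<alpha> z * norm (deriv (disc_kernel \<alpha> N a) z) \<le> real N * 2 ^ (N + 1)"
    if z: "z \<in> unit_disc" for z
  proof -
    define d where "d = norm (1 - cnj a * z)"
    note b = one_minus_cnj_mult_lower[OF a z, folded d_def s_def]
    have t: "0 \<le> 1 - (norm z)\<^sup>2" using one_minus_square_bounds[of "norm z"] z by auto
    have "norm a \<le> 1" using a by auto
    have "weight \<alpha> z * s powr (real N + 1 - \<alpha>) \<le> (2 * d) powr \<alpha> * (2 * d) powr (real N + 1 - \<alpha>)"
      unfolding weight_def using b t s \<alpha> by (intro mult_mono powr_mono2) auto
    also have "\<dots> = (2 * d) powr (real (N + 1))" by (simp add: powr_add[symmetric] add.commute)
    also have "\<dots> = (2 * d) ^ (N + 1)" using b by (intro powr_realpow) auto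
    finally have w: "weight \<alpha> z * s powr (real N + 1 - \<alpha>) \<le> 2 ^ (N + 1) * d ^ (N + 1)"
      by (simp only: power_mult_distrib)
    have "weight \<alpha> z * norm (deriv (disc_kernel \<alpha> N a) z) =
        real N * norm a * (weight \<alpha> z * s powr (real N + 1 - \<alpha>) / d ^ (N + 1))"
      using DERIV_imp_deriv[OF D[OF z]] by (simp add: norm_mult norm_divide norm_power d_def)
    also have "\<dots> \<le> real N * 1 * 2 ^ (N + 1)"
    proof (rule mult_mono)
      show "real N * norm a \<le> real N * 1"
        using \<open>norm a \<le> 1\<close> by (rule mult_left_mono) simp
      show "weight \<alpha> z * s powr (real N + 1 - \<alpha>) / d ^ (N + 1) \<le> 2 ^ (N + 1)"
        using w b(1) by (simp add: pos_divide_le_eq del: power_Suc)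
      show "0 \<le> weight \<alpha> z * s powr (real N + 1 - \<alpha>) / d ^ (N + 1)"
        by (simp add: d_def)
    qed simp
    finally show ?thesis by simp
  qed
  show "disc_kernel \<alpha> N a \<in> bloch_ball \<alpha> (1 + real N * 2 ^ (N + 1))"
  proof (rule bloch_ballI)
    show "disc_kernel \<alpha> N a holomorphic_on unit_disc"
      using D by (rule holomorphic_discI)
    have "s powr (real N + 1 - \<alpha>) \<le> 1" using s \<alpha> by (intro powr_le1) auto
    then show "norm (disc_kernel \<alpha> N a 0) \<le> 1 + real N * 2 ^ (N + 1)"
      by (simp add: disc_kernel_def s_def add_increasing2)
    show "weight \<alpha> z * norm (deriv (disc_kernel \<alpha> N a) z) \<le> 1 + real N * 2 ^ (N + 1)"
      if "z \<in> unit_disc" for z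
      using bd[OF that] by linarith
  qed
qed

text \<open>
  The growth estimate is sharp at every point: constants, \<open>ln (2 / (1 - cnj a z))\<close> and the kernels
  attain it for \<open>\<alpha> < 1\<close>, \<open>\<alpha> = 1\<close> and \<open>\<alpha> > 1\<close>, with bounds uniform in \<open>a\<close>.
\<close>

lemma zygmund_growth_attained:
  assumes "0 < \<alpha>"
  obtains Q where "0 \<le> Q"
    "\<And>a. a \<in> unit_disc \<Longrightarrow> \<exists>h\<in>bloch_ball \<alpha> Q. zygmund_growth \<alpha> (norm a) \<le> norm (h a)"
proof -
  consider "\<alpha> < 1" | "\<alpha> = 1" | "1 < \<alpha>" by linarith
  then show thesis
  proof cases
    case 1
    show thesis
    proof (rule that[of 1])
      show "\<exists>h\<in>bloch_ball \<alpha> 1. zygmund_growth \<alpha> (norm a) \<le> norm (h a)" for a :: complex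
        using 1 by (intro bexI[of _ "\<lambda>_. 1"]) (auto simp: zygmund_growth_def bloch_ball_def)
    qed simp
  next
    case 2
    show thesis
    proof (rule that[of 2])
      fix a :: complex assume a: "a \<in> unit_disc"
      define h where "h z = of_real (ln 2) - Ln (1 - cnj a * z)" for z
      have D: "(h has_field_derivative cnj a / (1 - cnj a * z)) (at z)" if z: "z \<in> unit_disc" for z
      proof -
        have "norm (cnj a * z) < 1"
          using a z mult_strict_mono[of "norm a" 1 "norm z" 1] by (simp add: norm_mult)
        then have "0 < Re (1 - cnj a * z)"
          using complex_Re_le_cmod[of "cnj a * z"] by simp
        then have "1 - cnj a * z \<notin> \<real>\<^sub>\<le>\<^sub>0" by (auto simp: complex_nonpos_Reals_iff)
        then show ?thesis
          unfolding h_def using one_minus_cnj_mult_lower(1)[OF a z]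
          by (auto intro!: derivative_eq_intros simp: field_simps)
      qed
      have hol: "h holomorphic_on unit_disc" using D by (rule holomorphic_discI)
      have h0: "norm (h 0) \<le> 2" using ln_2_less_1 by (simp add: h_def)
      have bd: "weight \<alpha> z * norm (deriv h z) \<le> 2" if z: "z \<in> unit_disc" for z
      proof -
        note b = one_minus_cnj_mult_lower[OF a z]
        have t: "0 < 1 - (norm z)\<^sup>2" using one_minus_square_bounds(1)[of "norm z"] z by auto
        have "(1 - (norm z)\<^sup>2) * norm a \<le> 2 * norm (1 - cnj a * z) * 1"
          using a b t by (intro mult_mono) auto
        then show ?thesis
          using DERIV_imp_deriv[OF D[OF z]] b t 2
          by (simp add: weight_def norm_divide pos_divide_le_eq)
      qed
      have s: "0 < 1 - (norm a)\<^sup>2" using one_minus_square_bounds(1)[of "norm a"] a by auto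
      have "h a = of_real (ln (2 / (1 - (norm a)\<^sup>2)))"
        unfolding h_def one_minus_cnj_mult_self using s by (subst Ln_of_real) (auto simp: ln_div)
      then have "zygmund_growth \<alpha> (norm a) \<le> norm (h a)"
        using 2 by (simp add: zygmund_growth_def)
      then show "\<exists>h\<in>bloch_ball \<alpha> 2. zygmund_growth \<alpha> (norm a) \<le> norm (h a)"
        using bloch_ballI[OF hol h0 bd] by blast
    qed simp
  next
    case 3
    define N where "N = nat \<lceil>\<alpha>\<rceil>"
    have N: "\<alpha> \<le> real N + 1"
      using real_nat_ceiling_ge[of \<alpha>] unfolding N_def by linarith
    show thesis
    proof (rule that[of "1 + real N * 2 ^ (N + 1)"])
      fix a :: complex assume a: "a \<in> unit_disc"
      note T = disc_kernel_test[OF a assms N]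
      have "zygmund_growth \<alpha> (norm a) \<le> norm (disc_kernel \<alpha> N a a)"
        using 3 by (simp add: zygmund_growth_def T(2))
      then show "\<exists>h\<in>bloch_ball \<alpha> (1 + real N * 2 ^ (N + 1)). zygmund_growth \<alpha> (norm a) \<le> norm (h a)"
        using T(1) by blast
    qed simp
  qed
qed

text \<open>
  The difference of two consecutive kernels vanishes at \<open>a\<close>, which removes the \<open>w\<close> term, and has
  derivative \<open>cnj a (1 - |a|\<^sup>2)\<^bsup>-\<alpha>\<^esup>\<close> there. The factor \<open>cnj a\<close> is harmless for \<open>|a| \<ge> 1/2\<close>. For smaller
  \<open>a\<close> the weight \<open>(1 - |a|\<^sup>2)\<^bsup>-\<alpha>\<^esup>\<close> is bounded, and testing on \<open>h = 1\<close> and \<open>h = id\<close> bounds \<open>w\<close> and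
  \<open>u + a w\<close>, hence \<open>u\<close>.
\<close>

lemma coeff2_bound_if_bounded:
  assumes "0 < \<alpha>" and bdd: "bounded_zygmund_operator \<alpha> \<beta> (CV \<phi> g)"
    and h\<phi>: "\<phi> holomorphic_on unit_disc" and \<phi>: "\<phi> ` unit_disc \<subseteq> unit_disc"
    and g: "g holomorphic_on unit_disc"
  shows "\<exists>M. \<forall>z\<in>unit_disc.
    weight \<beta> z * (1 - (norm (\<phi> z))\<^sup>2) powr (- \<alpha>) * norm (cv_coeff2 \<phi> g z) \<le> M"
proof -
  obtain C where C: "0 \<le> C" and test: "\<And>h N z. h \<in> bloch_ball \<alpha> N \<Longrightarrow> z \<in> unit_disc \<Longrightarrow>
      weight \<beta> z * norm (deriv h (\<phi> z) * cv_coeff2 \<phi> g z + h (\<phi> z) * cv_coeff1 \<phi> g z) \<le> C * N"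
    using bounded_CV_test[OF bdd h\<phi> \<phi> g] by blast
  define N where "N = nat \<lceil>\<alpha>\<rceil>"
  have N: "\<alpha> \<le> real N + 1" "\<alpha> \<le> real (N + 1) + 1"
    using real_nat_ceiling_ge[of \<alpha>] unfolding N_def by auto
  define P where "P = 1 + real (N + 1) * 2 ^ (N + 1 + 1) + (1 + real N * 2 ^ (N + 1))"
  have P: "0 \<le> P" by (simp add: P_def)
  define M where "M = 2 * (C * P) + 2 powr \<alpha> * (2 * C)"
  have "weight \<beta> z * (1 - (norm (\<phi> z))\<^sup>2) powr (- \<alpha>) * norm (cv_coeff2 \<phi> g z) \<le> M"
    if z: "z \<in> unit_disc" for z
  proof -
    define a where "a = \<phi> z"
    have a: "a \<in> unit_disc" unfolding a_def using \<phi> z by blast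
    define s where "s = 1 - (norm a)\<^sup>2"
    define u where "u = cv_coeff2 \<phi> g z"
    define w where "w = cv_coeff1 \<phi> g z"
    have s: "0 < s" using one_minus_square_bounds(1)[of "norm a"] a by (auto simp: s_def)
    show ?thesis
    proof (cases "1 / 2 \<le> norm a")
      case True
      define h where "h = (\<lambda>z. disc_kernel \<alpha> (N + 1) a z - disc_kernel \<alpha> N a z)"
      note T0 = disc_kernel_test[OF a assms(1) N(1)]
      note T1 = disc_kernel_test[OF a assms(1) N(2)]
      have h: "h \<in> bloch_ball \<alpha> P"
        unfolding h_def P_def by (rule bloch_ball_diff(1)[OF T1(1) T0(1)])
      have dh: "deriv h a = deriv (disc_kernel \<alpha> (N + 1) a) a - deriv (disc_kernel \<alpha> N a) a"
        unfolding h_def by (rule bloch_ball_diff(2)[OF T1(1) T0(1) a])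
      have "h a = 0" unfolding h_def T0(2) T1(2) by simp
      moreover have "deriv h a = cnj a * of_real (s powr (- \<alpha>))"
        unfolding dh T0(3) T1(3) s_def by (simp add: algebra_simps)
      ultimately have "weight \<beta> z * (norm a * s powr (- \<alpha>) * norm u) \<le> C * P"
        using test[OF h z] by (simp add: norm_mult flip: a_def u_def)
      moreover have "1 / 2 * (weight \<beta> z * s powr (- \<alpha>) * norm u) \<le>
          norm a * (weight \<beta> z * s powr (- \<alpha>) * norm u)"
        using True by (intro mult_right_mono) auto
      ultimately have "weight \<beta> z * s powr (- \<alpha>) * norm u \<le> 2 * (C * P)"
        by (simp add: mult_ac)
      also have "\<dots> \<le> M" using C by (simp add: M_def)
      finally show ?thesis by (simp add: s_def a_def u_def)
    next
      case False
      have "weight \<beta> z * norm (deriv (\<lambda>_. 1) (\<phi> z) * u + 1 * w) \<le> C * 1"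
        unfolding u_def w_def using z by (intro test) (auto simp: bloch_ball_def)
      then have w: "weight \<beta> z * norm w \<le> C" by simp
      have "weight \<alpha> x * norm (deriv (\<lambda>z. z) x) \<le> 1" if "x \<in> unit_disc" for x
        using that assms(1) one_minus_square_bounds[of "norm x"]
        by (auto simp: weight_def intro!: powr_le1)
      then have "weight \<beta> z * norm (deriv (\<lambda>z. z) (\<phi> z) * u + \<phi> z * w) \<le> C * 1"
        unfolding u_def w_def using z by (intro test bloch_ballI holomorphic_intros) auto
      then have uw: "weight \<beta> z * norm (u + a * w) \<le> C" by (simp add: a_def)
      have "norm u \<le> norm (u + a * w) + norm (a * w)"
        using norm_triangle_ineq4[of "u + a * w" "a * w"] by simp
      also have "\<dots> \<le> norm (u + a * w) + 1 * norm w"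
        unfolding norm_mult using False by (intro add_mono mult_right_mono) auto
      finally have "weight \<beta> z * norm u \<le> weight \<beta> z * (norm (u + a * w) + norm w)"
        by (intro mult_left_mono) auto
      then have u: "weight \<beta> z * norm u \<le> 2 * C"
        using w uw unfolding distrib_left by linarith
      have "(norm a)\<^sup>2 \<le> (1 / 2)\<^sup>2" using False by (intro power_mono) auto
      then have "1 / 2 \<le> s" by (simp add: s_def power2_eq_square)
      then have "s powr (- \<alpha>) \<le> (1 / 2) powr (- \<alpha>)"
        using assms(1) by (intro powr_mono2') auto
      also have "\<dots> = 2 powr \<alpha>" by (simp add: powr_divide powr_minus)
      finally have "s powr (- \<alpha>) \<le> 2 powr \<alpha>" .
      then have "s powr (- \<alpha>) * (weight \<beta> z * norm u) \<le> 2 powr \<alpha> * (2 * C)"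
        by (rule mult_mono[OF _ u]) auto
      also have "\<dots> \<le> M" using C P by (simp add: M_def)
      finally show ?thesis by (simp add: s_def a_def u_def mult_ac)
    qed
  qed
  then show ?thesis by blast
qed

text \<open>
  An extremal \<open>h\<close> for the growth at \<open>a = \<phi> z\<close> need not have \<open>h' a = 0\<close>, but \<open>|h' a|\<close> is at most
  \<open>Q (1 - |a|\<^sup>2)\<^bsup>-\<alpha>\<^esup>\<close>, so the \<open>u\<close> term is bounded by the estimate already proved and can be subtracted.
\<close>

lemma coeff1_bound_if_bounded:
  assumes "0 < \<alpha>" and bdd: "bounded_zygmund_operator \<alpha> \<beta> (CV \<phi> g)"
    and h\<phi>: "\<phi> holomorphic_on unit_disc" and \<phi>: "\<phi> ` unit_disc \<subseteq> unit_disc"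
    and g: "g holomorphic_on unit_disc"
  shows "\<exists>M. \<forall>z\<in>unit_disc.
    weight \<beta> z * zygmund_growth \<alpha> (norm (\<phi> z)) * norm (cv_coeff1 \<phi> g z) \<le> M"
proof -
  obtain C where C: "0 \<le> C" and test: "\<And>h N z. h \<in> bloch_ball \<alpha> N \<Longrightarrow> z \<in> unit_disc \<Longrightarrow>
      weight \<beta> z * norm (deriv h (\<phi> z) * cv_coeff2 \<phi> g z + h (\<phi> z) * cv_coeff1 \<phi> g z) \<le> C * N"
    using bounded_CV_test[OF bdd h\<phi> \<phi> g] by blast
  obtain M where M: "\<And>z. z \<in> unit_disc \<Longrightarrow>
      weight \<beta> z * (1 - (norm (\<phi> z))\<^sup>2) powr (- \<alpha>) * norm (cv_coeff2 \<phi> g z) \<le> M"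
    using coeff2_bound_if_bounded[OF assms] by blast
  obtain Q where Q: "0 \<le> Q"
    and peak: "\<And>a. a \<in> unit_disc \<Longrightarrow>
      \<exists>h\<in>bloch_ball \<alpha> Q. zygmund_growth \<alpha> (norm a) \<le> norm (h a)"
    using that by (rule zygmund_growth_attained[OF assms(1)])
  have "weight \<beta> z * zygmund_growth \<alpha> (norm (\<phi> z)) * norm (cv_coeff1 \<phi> g z) \<le> C * Q + Q * M"
    if z: "z \<in> unit_disc" for z
  proof -
    define a where "a = \<phi> z"
    have a: "a \<in> unit_disc" unfolding a_def using \<phi> z by blast
    define s where "s = 1 - (norm a)\<^sup>2"
    define u where "u = cv_coeff2 \<phi> g z"
    define w where "w = cv_coeff1 \<phi> g z"
    have s: "0 < s" using one_minus_square_bounds(1)[of "norm a"] a by (auto simp: s_def)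
    obtain h where h: "h \<in> bloch_ball \<alpha> Q" "zygmund_growth \<alpha> (norm a) \<le> norm (h a)"
      using peak[OF a] by blast
    have sum: "weight \<beta> z * norm (deriv h a * u + h a * w) \<le> C * Q"
      using test[OF h(1) z] by (simp add: a_def u_def w_def)
    have "s powr \<alpha> * norm (deriv h a) \<le> Q"
      using bloch_ballD(4)[OF h(1) a] by (simp add: weight_def s_def)
    then have "norm (deriv h a) \<le> Q * s powr (- \<alpha>)"
      using s by (simp add: powr_minus field_simps)
    then have "weight \<beta> z * norm u * norm (deriv h a) \<le> weight \<beta> z * norm u * (Q * s powr (- \<alpha>))"
      by (intro mult_left_mono) auto
    also have "\<dots> = Q * (weight \<beta> z * s powr (- \<alpha>) * norm u)" by (simp add: mult_ac)
    also have "\<dots> \<le> Q * M"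
      using M[OF z] Q by (intro mult_left_mono) (auto simp: s_def a_def u_def)
    finally have du: "weight \<beta> z * norm (deriv h a * u) \<le> Q * M"
      by (simp add: norm_mult mult_ac)
    have "norm (h a * w) \<le> norm (deriv h a * u + h a * w) + norm (deriv h a * u)"
      using norm_triangle_ineq4[of "deriv h a * u + h a * w" "deriv h a * u"] by simp
    then have "weight \<beta> z * norm (h a * w) \<le>
        weight \<beta> z * (norm (deriv h a * u + h a * w) + norm (deriv h a * u))"
      by (intro mult_left_mono) auto
    then have hw: "weight \<beta> z * norm (h a * w) \<le> C * Q + Q * M"
      using sum du unfolding distrib_left by linarith
    have "weight \<beta> z * norm w * zygmund_growth \<alpha> (norm a) \<le> weight \<beta> z * norm w * norm (h a)"
      using h(2) by (intro mult_left_mono) auto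
    then show ?thesis
      using hw by (simp add: norm_mult mult_ac a_def w_def)
  qed
  then show ?thesis by blast
qed

section \<open>The characterization\<close>

lemma bounded_CV_iff:
  assumes "0 < \<alpha>" "\<phi> holomorphic_on unit_disc" "\<phi> ` unit_disc \<subseteq> unit_disc"
    "g holomorphic_on unit_disc"
  shows "bounded_zygmund_operator \<alpha> \<beta> (CV \<phi> g) \<longleftrightarrow>
    (\<exists>M. \<forall>z\<in>unit_disc. weight \<beta> z * (1 - (norm (\<phi> z))\<^sup>2) powr (- \<alpha>) * norm (cv_coeff2 \<phi> g z) \<le> M) \<and>
    (\<exists>M. \<forall>z\<in>unit_disc. weight \<beta> z * zygmund_growth \<alpha> (norm (\<phi> z)) * norm (cv_coeff1 \<phi> g z) \<le> M)"
    (is "?bdd \<longleftrightarrow> ?M2 \<and> ?M1")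
proof
  assume ?bdd
  then show "?M2 \<and> ?M1"
    using coeff2_bound_if_bounded[OF assms(1) _ assms(2-4)]
      coeff1_bound_if_bounded[OF assms(1) _ assms(2-4)] by (intro conjI)
next
  assume "?M2 \<and> ?M1"
  then obtain M2 M1 where b2: "\<forall>z\<in>unit_disc.
      weight \<beta> z * (1 - (norm (\<phi> z))\<^sup>2) powr (- \<alpha>) * norm (cv_coeff2 \<phi> g z) \<le> M2"
    and b1: "\<forall>z\<in>unit_disc.
      weight \<beta> z * zygmund_growth \<alpha> (norm (\<phi> z)) * norm (cv_coeff1 \<phi> g z) \<le> M1"
    by (elim conjE exE)
  show ?bdd by (rule CV_bounded_if_coeff_bounds[OF assms bspec[OF b2] bspec[OF b1]])
qed

text \<open>
  The constants in the next three lemmas depend on the exponent only, never on \<open>\<phi>\<close> and \<open>U\<close>.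
\<close>

lemma comparable_finite_power:
  assumes "0 < \<gamma>" and self: "\<phi> ` unit_disc \<subseteq> unit_disc"
  shows "comparable_finite (1 / ((2 * \<gamma>) powr \<gamma> * exp 1)) (1 / (2 powr (- \<gamma>) / 2))
      (SUP n::nat. ennreal ((real n + 1) powr \<gamma>) * weighted_norm \<beta> (\<lambda>z. U z * \<phi> z ^ n))
      (SUP z\<in>unit_disc. ennreal ((1 - (norm z)\<^sup>2) powr \<beta> / (1 - (norm (\<phi> z))\<^sup>2) powr \<gamma> * norm (U z)))
    \<longleftrightarrow> (\<exists>M. \<forall>z\<in>unit_disc. weight \<beta> z * (1 - (norm (\<phi> z))\<^sup>2) powr (- \<gamma>) * norm (U z) \<le> M)"
proof -
  have w: "(1 - (norm z)\<^sup>2) powr \<beta> / (1 - (norm (\<phi> z))\<^sup>2) powr \<gamma> =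
      weight \<beta> z * (1 - (norm (\<phi> z))\<^sup>2) powr (- \<gamma>)" for z
    by (simp add: weight_def powr_minus divide_inverse)
  show ?thesis
    unfolding w
    by (rule comparable_finite_moments[where \<omega> = "\<lambda>r. (1 - r\<^sup>2) powr (- \<gamma>)"])
      (use assms power_moment_upper[OF assms(1)] power_moment_lower[OF assms(1)] in auto)
qed

lemma comparable_finite_linear:
  assumes self: "\<phi> ` unit_disc \<subseteq> unit_disc"
  shows "comparable_finite (1 / (2 * exp 1)) 4
      (SUP n::nat. ennreal (real n + 1) * weighted_norm \<beta> (\<lambda>z. U z * \<phi> z ^ n))
      (SUP z\<in>unit_disc. ennreal ((1 - (norm z)\<^sup>2) powr \<beta> / (1 - (norm (\<phi> z))\<^sup>2) * norm (U z)))
    \<longleftrightarrow> (\<exists>M. \<forall>z\<in>unit_disc. weight \<beta> z * (1 - (norm (\<phi> z))\<^sup>2) powr (- 1) * norm (U z) \<le> M)"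
proof -
  have "(1 - (norm (\<phi> z))\<^sup>2) powr 1 = 1 - (norm (\<phi> z))\<^sup>2" if "z \<in> unit_disc" for z
  proof -
    have "\<phi> z \<in> unit_disc" using self that by blast
    then show ?thesis using one_minus_square_bounds(1)[of "norm (\<phi> z)"] by simp
  qed
  then have B: "(SUP z\<in>unit_disc. ennreal ((1 - (norm z)\<^sup>2) powr \<beta> / (1 - (norm (\<phi> z))\<^sup>2) powr 1 * norm (U z))) =
      (SUP z\<in>unit_disc. ennreal ((1 - (norm z)\<^sup>2) powr \<beta> / (1 - (norm (\<phi> z))\<^sup>2) * norm (U z)))"
    by (intro SUP_cong) auto
  have A: "(real n + 1) powr 1 = real n + 1" for n by simp
  have C: "(2 * 1) powr 1 * exp 1 = 2 * exp (1::real)" "1 / (2 powr (- 1) / 2) = (4::real)"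
    by (simp_all add: powr_minus)
  show ?thesis
    using comparable_finite_power[OF zero_less_one self, of \<beta> U] unfolding A B C .
qed

lemma comparable_finite_log:
  assumes self: "\<phi> ` unit_disc \<subseteq> unit_disc"
  shows "comparable_finite (1 / (1 + 2 * exp 1 / ln 2)) (1 / (1 / 4))
      (SUP n::nat. ennreal (ln (real n + 2)) * weighted_norm \<beta> (\<lambda>z. U z * \<phi> z ^ n))
      (SUP z\<in>unit_disc. ennreal ((1 - (norm z)\<^sup>2) powr \<beta> * ln (2 / (1 - (norm (\<phi> z))\<^sup>2)) * norm (U z)))
    \<longleftrightarrow> (\<exists>M. \<forall>z\<in>unit_disc. weight \<beta> z * ln (2 / (1 - (norm (\<phi> z))\<^sup>2)) * norm (U z) \<le> M)"
  unfolding weight_def[symmetric]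
proof (rule comparable_finite_moments[where \<omega> = "\<lambda>r. ln (2 / (1 - r\<^sup>2))"])
  show "0 < 1 + 2 * exp 1 / ln (2::real)" by (intro add_pos_pos divide_pos_pos) auto
qed (use self log_moment_upper log_moment_lower in auto)

lemma cv_coeff1_holomorphic:
  assumes "\<phi> holomorphic_on unit_disc" "\<phi> ` unit_disc \<subseteq> unit_disc" "g holomorphic_on unit_disc"
  shows "cv_coeff1 \<phi> g holomorphic_on unit_disc"
proof -
  have comp: "(\<lambda>z. f (\<phi> z)) holomorphic_on unit_disc" if "f holomorphic_on unit_disc" for f
    using holomorphic_on_compose_gen[OF assms(1) that assms(2)] by (simp add: o_def)
  note d\<phi> = holomorphic_deriv_disc[OF assms(1)]
  show ?thesis
    unfolding cv_coeff1_def[abs_def]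
    using comp[OF assms(3)] comp[OF holomorphic_deriv_disc[OF assms(3)]]
      d\<phi> holomorphic_deriv_disc[OF d\<phi>]
    by (intro holomorphic_on_add holomorphic_on_mult holomorphic_on_power)
qed

lemma weighted_Hinf_iff:
  "h \<in> weighted_Hinf \<beta> \<longleftrightarrow>
    h holomorphic_on unit_disc \<and> (\<exists>M. \<forall>z\<in>unit_disc. weight \<beta> z * norm (h z) \<le> M)"
  unfolding weighted_Hinf_def weighted_norm_def mem_Collect_eq SUP_ennreal_finite_iff ..

theorem theorem2p2:
  fixes \<alpha> \<beta> :: real
  assumes "0 < \<alpha>" and "0 < \<beta>"
  shows
    "(\<alpha> < 1 \<longrightarrow>
       (\<exists>C1>0. \<exists>C2>0. \<forall>\<phi> g.
          \<phi> holomorphic_on unit_disc \<and> \<phi> ` unit_disc \<subseteq> unit_disc \<and> g holomorphic_on unit_disc \<longrightarrow>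
          (bounded_zygmund_operator \<alpha> \<beta> (CV \<phi> g) \<longleftrightarrow>
             (\<lambda>z. g (\<phi> z) * deriv (deriv \<phi>) z + deriv g (\<phi> z) * (deriv \<phi> z)\<^sup>2) \<in> weighted_Hinf \<beta> \<and>
             comparable_finite C1 C2
               (SUP n::nat. ennreal ((real n + 1) powr \<alpha>) *
                  weighted_norm \<beta> (\<lambda>z. g (\<phi> z) * (deriv \<phi> z)\<^sup>2 * \<phi> z ^ n))
               (SUP z\<in>unit_disc. ennreal ((1 - (norm z)\<^sup>2) powr \<beta> / (1 - (norm (\<phi> z))\<^sup>2) powr \<alpha> *
                  norm (g (\<phi> z) * (deriv \<phi> z)\<^sup>2)))))) \<and>
     (\<alpha> = 1 \<longrightarrow>
       (\<exists>C1>0. \<exists>C2>0. \<exists>C3>0. \<exists>C4>0. \<forall>\<phi> g.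
          \<phi> holomorphic_on unit_disc \<and> \<phi> ` unit_disc \<subseteq> unit_disc \<and> g holomorphic_on unit_disc \<longrightarrow>
          (bounded_zygmund_operator \<alpha> \<beta> (CV \<phi> g) \<longleftrightarrow>
             comparable_finite C1 C2
               (SUP n::nat. ennreal (real n + 1) *
                  weighted_norm \<beta> (\<lambda>z. g (\<phi> z) * (deriv \<phi> z)\<^sup>2 * \<phi> z ^ n))
               (SUP z\<in>unit_disc. ennreal ((1 - (norm z)\<^sup>2) powr \<beta> / (1 - (norm (\<phi> z))\<^sup>2) *
                  norm (g (\<phi> z) * (deriv \<phi> z)\<^sup>2))) \<and>
             comparable_finite C3 C4
               (SUP n::nat. ennreal (ln (real n + 2)) *
                  weighted_norm \<beta> (\<lambda>z. (deriv g (\<phi> z) * (deriv \<phi> z)\<^sup>2 + g (\<phi> z) * deriv (deriv \<phi>) z) * \<phi> z ^ n))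
               (SUP z\<in>unit_disc. ennreal ((1 - (norm z)\<^sup>2) powr \<beta> * ln (2 / (1 - (norm (\<phi> z))\<^sup>2)) *
                  norm (deriv g (\<phi> z) * (deriv \<phi> z)\<^sup>2 + g (\<phi> z) * deriv (deriv \<phi>) z)))))) \<and>
     (1 < \<alpha> \<longrightarrow>
       (\<exists>C1>0. \<exists>C2>0. \<exists>C3>0. \<exists>C4>0. \<forall>\<phi> g.
          \<phi> holomorphic_on unit_disc \<and> \<phi> ` unit_disc \<subseteq> unit_disc \<and> g holomorphic_on unit_disc \<longrightarrow>
          (bounded_zygmund_operator \<alpha> \<beta> (CV \<phi> g) \<longleftrightarrow>
             comparable_finite C1 C2
               (SUP n::nat. ennreal ((real n + 1) powr \<alpha>) *
                  weighted_norm \<beta> (\<lambda>z. g (\<phi> z) * (deriv \<phi> z)\<^sup>2 * \<phi> z ^ n))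
               (SUP z\<in>unit_disc. ennreal ((1 - (norm z)\<^sup>2) powr \<beta> / (1 - (norm (\<phi> z))\<^sup>2) powr \<alpha> *
                  norm (g (\<phi> z) * (deriv \<phi> z)\<^sup>2))) \<and>
             comparable_finite C3 C4
               (SUP n::nat. ennreal ((real n + 1) powr (\<alpha> - 1)) *
                  weighted_norm \<beta> (\<lambda>z. (deriv g (\<phi> z) * (deriv \<phi> z)\<^sup>2 + g (\<phi> z) * deriv (deriv \<phi>) z) * \<phi> z ^ n))
               (SUP z\<in>unit_disc. ennreal ((1 - (norm z)\<^sup>2) powr \<beta> / (1 - (norm (\<phi> z))\<^sup>2) powr (\<alpha> - 1) *
                  norm (deriv g (\<phi> z) * (deriv \<phi> z)\<^sup>2 + g (\<phi> z) * deriv (deriv \<phi>) z))))))"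
proof -
  let "(_ \<longrightarrow> ?case1) \<and> (_ \<longrightarrow> ?case2) \<and> (_ \<longrightarrow> ?case3)" = ?thesis
  have pos: "0 < 1 / ((2 * \<gamma>) powr \<gamma> * exp 1)" "0 < 1 / (2 powr (- \<gamma>) / 2)"
    if "0 < \<gamma>" for \<gamma> :: real
    using that by auto
  have pos_log: "0 < 1 / (1 + 2 * exp 1 / ln (2::real))" "0 < 1 / (1 / 4 :: real)"
    by (auto intro!: add_pos_pos divide_pos_pos)
  have pos_linear: "0 < 1 / (2 * exp (1::real))" "0 < (4::real)" by auto
  show ?thesis
  proof (intro conjI impI)
    assume "\<alpha> < 1"
    then have growth: "zygmund_growth \<alpha> = (\<lambda>r. 1)"
      by (simp add: zygmund_growth_def fun_eq_iff)
    note C = pos[OF assms(1)]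
    show ?case1
    proof (rule exI, rule conjI, rule C(1), rule exI, rule conjI, rule C(2),
        intro allI impI, elim conjE, goal_cases)
      case (1 \<phi> g)
      note H = this
      have w: "(\<lambda>z. g (\<phi> z) * deriv (deriv \<phi>) z + deriv g (\<phi> z) * (deriv \<phi> z)\<^sup>2) = cv_coeff1 \<phi> g"
        by (simp add: cv_coeff1_def fun_eq_iff add.commute)
      have "cv_coeff1 \<phi> g \<in> weighted_Hinf \<beta> \<longleftrightarrow>
          (\<exists>M. \<forall>z\<in>unit_disc. weight \<beta> z * 1 * norm (cv_coeff1 \<phi> g z) \<le> M)"
        using cv_coeff1_holomorphic[OF H] by (simp add: weighted_Hinf_iff)
      then show ?case
        unfolding w comparable_finite_power[OF assms(1) H(2)]
          bounded_CV_iff[OF assms(1) H] growth cv_coeff2_def by (simp only: conj_commute)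
    qed
  next
    assume "\<alpha> = 1"
    then have growth: "zygmund_growth \<alpha> = (\<lambda>r. ln (2 / (1 - r\<^sup>2)))"
      by (simp add: zygmund_growth_def fun_eq_iff)
    show ?case2
    proof (rule exI, rule conjI, rule pos_linear(1), rule exI, rule conjI, rule pos_linear(2),
        rule exI, rule conjI, rule pos_log(1), rule exI, rule conjI, rule pos_log(2),
        intro allI impI, elim conjE, goal_cases)
      case (1 \<phi> g)
      show ?case
        unfolding comparable_finite_linear[OF 1(2)] comparable_finite_log[OF 1(2)]
          bounded_CV_iff[OF assms(1) 1] growth cv_coeff1_def cv_coeff2_def
        unfolding \<open>\<alpha> = 1\<close> by (rule refl)
    qed
  next
    assume "1 < \<alpha>"
    then have growth: "zygmund_growth \<alpha> = (\<lambda>r. (1 - r\<^sup>2) powr (- (\<alpha> - 1)))"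
      by (simp add: zygmund_growth_def fun_eq_iff)
    have \<alpha>1: "0 < \<alpha> - 1" using \<open>1 < \<alpha>\<close> by simp
    note C = pos[OF assms(1)] pos[OF \<alpha>1]
    show ?case3
    proof (rule exI, rule conjI, rule C(1), rule exI, rule conjI, rule C(2),
        rule exI, rule conjI, rule C(3), rule exI, rule conjI, rule C(4),
        intro allI impI, elim conjE, goal_cases)
      case (1 \<phi> g)
      show ?case
        unfolding comparable_finite_power[OF assms(1) 1(2)] comparable_finite_power[OF \<alpha>1 1(2)]
          bounded_CV_iff[OF assms(1) 1] growth cv_coeff1_def cv_coeff2_def
        by (rule refl)
    qed
  qed
qed

end
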